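(* Let $b>0$, let $q:[-b,b]\to\mathbb{C}$ be continuous, and suppose there is a solution $f\in C^2[-b,b]$ of $f''-qf=0$ on $[-b,b]$ with $f(x)\ne0$ for all $x\in[-b,b]$ and $f(0)=1$. Suppose that for some function $g\in C[-b,b]$, some integer $r\ge0$ and some positive constants $M$ and $\varepsilon$, $$\mathcal{E}_n^f(g)\le\frac{M}{n^{r+\varepsilon}}\qquad\text{for all }n\in\mathbb{N}.$$ Then $g$ possesses $f$-derivatives of order $r$ in $(-b,b)$ and $f$-derivatives of order at least $[r/2]$ at the endpoints $\pm b$, where $[\cdot]$ denotes the integer part of a number.
   Context: Functions $\varphi_k$: let $\widetilde X^{(0)}\equiv X^{(0)}\equiv1$ and, for $n\ge1$, $\widetilde X^{(n)}(x)=n\int_0^x\widetilde X^{(n-1)}(s)(f^2(s))^{(-1)^{n-1}}ds$, $X^{(n)}(x)=n\int_0^xX^{(n-1)}(s)(f^2(s))^{(-1)^{n}}ds$; set $\varphi_k=fX^{(k)}$ for $k$ odd and $\varphi_k=f\widetilde X^{(k)}$ for $k$ even. Let $\Phi_n$ be the linear span (over $\mathbb{C}$) of $\varphi_0,\ldots,\varphi_n$. For $g\in C[-b,b]$, $\mathcal{E}_n^f(g)=\min_{h_n\in\Phi_n}\|g-h_n\|$, where $\|\cdot\|$ is the uniform norm on $[-b,b]$. $f$-derivatives: $d_0^f[g]=g$ and, for $k\ge1$, $d_k^f[g]=f^{(-1)^{k-1}}\frac{d}{dx}\big(f^{(-1)^k}d_{k-1}^f[g]\big)$, whenever this makes sense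 (so $d_k^f[g]=f\frac{d}{dx}(\frac1f d_{k-1}^f[g])$ for $k$ odd and $d_k^f[g]=\frac1f\frac{d}{dx}(f\,d_{k-1}^f[g])$ for $k$ even); derivatives at $\pm b$ are one-sided. *)

theory Defs
  imports "HOL-Analysis.Analysis"
begin

definition C2_solution :: "real \<Rightarrow> (real \<Rightarrow> complex) \<Rightarrow> (real \<Rightarrow> complex) \<Rightarrow> bool" where
  "C2_solution b q f \<longleftrightarrow>
     (\<exists>f' f''.
        (\<forall>x\<in>{-b..b}. (f has_vector_derivative f' x) (at x within {-b..b})) \<and>
        (\<forall>x\<in>{-b..b}. (f' has_vector_derivative f'' x) (at x within {-b..b})) \<and>
        continuous_on {-b..b} f'' \<and>
        (\<forall>x\<in>{-b..b}. f'' x - q x * f x = 0))"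

text \<open>The two families of recursive integrals. The interval integral is oriented, so for
  \<open>x < 0\<close> it is minus the integral over \<open>[x, 0]\<close>.\<close>

primrec X_tilde :: "(real \<Rightarrow> complex) \<Rightarrow> nat \<Rightarrow> real \<Rightarrow> complex" where
  "X_tilde f 0 = (\<lambda>x. 1)"
| "X_tilde f (Suc n) =
     (\<lambda>x. of_nat (Suc n) * (LBINT s=0..x. X_tilde f n s * ((f s)\<^sup>2) powi ((-1) ^ n)))"

primrec X_plain :: "(real \<Rightarrow> complex) \<Rightarrow> nat \<Rightarrow> real \<Rightarrow> complex" where
  "X_plain f 0 = (\<lambda>x. 1)"
| "X_plain f (Suc n) =
     (\<lambda>x. of_nat (Suc n) * (LBINT s=0..x. X_plain f n s * ((f s)\<^sup>2) powi ((-1) ^ Suc n)))"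

definition phi :: "(real \<Rightarrow> complex) \<Rightarrow> nat \<Rightarrow> real \<Rightarrow> complex" where
  "phi f k = (\<lambda>x. f x * (if odd k then X_plain f k x else X_tilde f k x))"

definition Phi :: "(real \<Rightarrow> complex) \<Rightarrow> nat \<Rightarrow> (real \<Rightarrow> complex) set" where
  "Phi f n = {h. \<exists>c :: nat \<Rightarrow> complex. h = (\<lambda>x. \<Sum>k\<le>n. c k * phi f k x)}"

definition unif_norm :: "real \<Rightarrow> (real \<Rightarrow> complex) \<Rightarrow> real" where
  "unif_norm b h = (SUP x\<in>{-b..b}. cmod (h x))"

text \<open>The span is finite-dimensional, so for continuous \<open>f\<close> and \<open>g\<close> with \<open>f\<close> nonvanishing on
  \<open>[-b, b]\<close> this infimum is attained, i.e. it is the minimal distance.\<close>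

definition best_approx :: "real \<Rightarrow> (real \<Rightarrow> complex) \<Rightarrow> nat \<Rightarrow> (real \<Rightarrow> complex) \<Rightarrow> real" where
  "best_approx b f n g = (INF h\<in>Phi f n. unif_norm b (\<lambda>x. g x - h x))"

text \<open>Derivatives are taken within \<open>[-b, b]\<close>: two-sided at interior points, one-sided at the
  endpoints. The value of \<open>f_deriv\<close> is meaningful only where \<open>has_f_deriv\<close> holds.\<close>

primrec f_deriv ::
  "real \<Rightarrow> (real \<Rightarrow> complex) \<Rightarrow> (real \<Rightarrow> complex) \<Rightarrow> nat \<Rightarrow> real \<Rightarrow> complex" where
  "f_deriv b f g 0 = g"
| "f_deriv b f g (Suc k) =
     (\<lambda>x. f x powi ((-1) ^ k) *
        vector_derivative (\<lambda>s. f s powi ((-1) ^ Suc k) * f_deriv b f g k s)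
          (at x within {-b..b}))"

text \<open>Existence of the \<open>f\<close>-derivative of order \<open>k + 1\<close> at \<open>x\<close> requires the one of order \<open>k\<close> to
  exist at \<open>x\<close> and at all nearby points of \<open>[-b, b]\<close>.\<close>

primrec has_f_deriv ::
  "real \<Rightarrow> (real \<Rightarrow> complex) \<Rightarrow> (real \<Rightarrow> complex) \<Rightarrow> nat \<Rightarrow> real \<Rightarrow> bool" where
  "has_f_deriv b f g 0 = (\<lambda>x. True)"
| "has_f_deriv b f g (Suc k) =
     (\<lambda>x. has_f_deriv b f g k x \<and>
        (\<forall>\<^sub>F y in at x within {-b..b}. has_f_deriv b f g k y) \<and>
        (\<lambda>s. f s powi ((-1) ^ Suc k) * f_deriv b f g k s)
          differentiable (at x within {-b..b}))"

end

theory Submission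
  imports Defs "HOL-Complex_Analysis.Complex_Analysis"
begin

text \<open>The idea is to transport the problem to polynomials. Let \<open>T\<close> be the linear map that sends
  \<open>x\<^sup>k\<close> to \<open>\<phi>\<^sub>k\<close>, so that \<open>\<Phi>\<^sub>n\<close> is the image under \<open>T\<close> of the
  polynomials of degree at most \<open>n\<close>, and let \<open>T'\<close> be the same map built from \<open>1/f\<close> instead of
  \<open>f\<close>. Passing from \<open>f\<close> to \<open>1/f\<close> swaps the families \<open>X\<close> and
  \<open>X\<close>-tilde, and therefore \<open>f (T p / f)' = T' (p')\<close> and \<open>(1/f) (f T' p)' = T (p')\<close>:
  on \<open>\<Phi>\<^sub>n\<close> the \<open>k\<close>-th \<open>f\<close>-derivative is ordinary \<open>k\<close>-fold
  differentiation of the polynomial, followed by \<open>T\<close> or \<open>T'\<close>.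

  What makes this useful is that \<open>p\<close> and \<open>T p\<close> have comparable uniform norms on every interval
  \<open>[-a, a]\<close> with \<open>a \<le> b\<close> (lemmas \<open>poly_map_upper\<close> and \<open>poly_map_lower\<close>).
  Let \<open>W(x, t)\<close> and \<open>V(x, t)\<close> be the values at \<open>x\<close> of \<open>T\<close> and \<open>T'\<close>
  applied to the translate \<open>p(\<cdot> + t)\<close>. The two relations above say that \<open>A = W + V\<close> and
  \<open>B = W - V\<close> solve the hyperbolic system
  \<open>A\<^sub>x - A\<^sub>t = \<kappa> B\<close>, \<open>B\<^sub>x + B\<^sub>t = \<kappa> A\<close> with
  \<open>\<kappa> = f'/f\<close>. At \<open>x = 0\<close> its data are \<open>A = 2 p\<close>, \<open>B = 0\<close>,
  and at \<open>t = 0\<close> one reads off \<open>W = T p\<close>, which gives the upper estimate. For the lower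
  one, \<open>p(\<cdot> + t)\<close> is replaced by its even part in \<open>t\<close> for \<open>W\<close> and by its odd
  part for \<open>V\<close>. Then \<open>W = T p\<close> and \<open>V = 0\<close> at \<open>t = 0\<close>, the
  system is solved in the direction of \<open>t\<close>, and at \<open>x = 0\<close> it yields
  \<open>W + V = p(t)\<close>. Both estimates are then instances of
  \<open>hyperbolic_system_bound\<close>, an a priori bound on a triangle of determinacy.

  For polynomials of degree at most \<open>n\<close>, \<open>k\<close>-fold differentiation costs a factor of order
  \<open>n\<^sup>k\<close> on compact subsets of the open interval (Bernstein) and
  \<open>n\<^bsup>2k\<^esup>\<close> up to the endpoints (Markov). Both come from one argument:
  a polynomial that is bounded on \<open>[-1, 1]\<close> is still bounded on the ellipse of sum of semi-axes
  \<open>1 + O(1/n)\<close> with foci \<open>\<plusminus>1\<close>, which contains the disc of radius of order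
  \<open>1/n\<close> about an interior point and of radius of order \<open>1/n\<^sup>2\<close> about any point of
  the interval, and Cauchy's inequality applies on that disc.

  Finally let \<open>h\<^sub>j = T p\<^sub>j\<close> be a nearly best approximation of \<open>g\<close> from
  \<open>\<Phi>\<^sub>n\<close> with \<open>n = 2\<^sup>j\<close>. The increments \<open>h\<^sub>j\<^sub>+\<^sub>1 - h\<^sub>j\<close>
  are of size \<open>2\<^bsup>-j(r+\<epsilon>)\<^esup>\<close>, hence so are those of \<open>p\<^sub>j\<close>, and
  the \<open>k\<close>-th \<open>f\<close>-derivatives of the increments are \<open>O(2\<^bsup>-j\<epsilon>\<^esup>)\<close> for
  \<open>k \<le> r\<close> inside the interval and for \<open>2k \<le> r\<close> on all of it. So the
  \<open>f\<close>-derivatives of \<open>h\<^sub>j\<close> converge uniformly, and their limits are the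
  \<open>f\<close>-derivatives of \<open>g\<close>.\<close>

section \<open>Markov and Bernstein inequalities\<close>

text \<open>The Joukowski map \<open>w \<mapsto> (w + 1/w) / 2\<close> sends the circles about \<open>0\<close> to the ellipses with
  foci \<open>\<plusminus>1\<close>. The sum of the distances to the foci therefore depends on \<open>\<bar>w\<bar>\<close>
  alone, which lets one measure in the plane of \<open>z\<close> how far \<open>w\<close> is from the unit circle.\<close>

lemma joukowski_preimage:
  fixes z :: complex
  obtains w where "w \<noteq> 0" "norm w \<le> 1" "z = (w + inverse w) / 2"
    "cmod (z - 1) + cmod (z + 1) = cmod w + inverse (cmod w)"
proof -
  define u v where "u = z - csqrt (z\<^sup>2 - 1)" and "v = z + csqrt (z\<^sup>2 - 1)"
  have uv: "u * v = 1"
    by (simp add: u_def v_def algebra_simps flip: power2_eq_square)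
  have z: "z = (u + v) / 2"
    by (simp add: u_def v_def)
  have "\<exists>w. w \<noteq> 0 \<and> norm w \<le> 1 \<and> z = (w + inverse w) / 2"
  proof (cases "norm u \<le> 1")
    case True
    then show ?thesis
      using uv z by (intro exI[of _ u]) (auto simp: inverse_unique)
  next
    case False
    have "norm u * norm v = 1"
      using uv by (metis norm_mult norm_one)
    with False have "norm v \<le> 1"
      by (smt (verit) mult_less_cancel_right1 norm_ge_zero)
    then show ?thesis
      using uv z inverse_unique[of v u]
      by (intro exI[of _ v]) (auto simp: mult.commute add.commute)
  qed
  then obtain w where w: "w \<noteq> 0" "norm w \<le> 1" "z = (w + inverse w) / 2"
    by blast
  have "z - 1 = (w - 1)\<^sup>2 / (2 * w)" "z + 1 = (w + 1)\<^sup>2 / (2 * w)"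
    using w by (auto simp: field_simps power2_eq_square)
  then have "cmod (z - 1) + cmod (z + 1) = ((cmod (w - 1))\<^sup>2 + (cmod (w + 1))\<^sup>2) / (2 * cmod w)"
    by (simp add: norm_divide norm_mult norm_power add_divide_distrib)
  also have "(cmod (w - 1))\<^sup>2 + (cmod (w + 1))\<^sup>2 = 2 * (cmod w)\<^sup>2 + 2"
    by (simp only: cmod_power2) (simp add: power2_eq_square algebra_simps)
  also have "(2 * (cmod w)\<^sup>2 + 2) / (2 * cmod w) = cmod w + inverse (cmod w)"
    using w by (simp add: field_simps power2_eq_square)
  finally show ?thesis
    using w that by blast
qed

text \<open>The unit circle is mapped onto \<open>[-1, 1]\<close>, and multiplication by \<open>w\<^sup>n\<close> turns
  \<open>p((w + 1/w) / 2)\<close> into a polynomial in \<open>w\<close>. The maximum principle on the unit disc does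
  the rest.\<close>

lemma bernstein_walsh:
  fixes p :: "complex poly"
  assumes deg: "degree p \<le> n"
    and bound: "\<And>t. t \<in> {-1..1} \<Longrightarrow> cmod (poly p (of_real t)) \<le> N"
    and w: "w \<noteq> 0" "cmod w \<le> 1"
  shows "cmod (poly p ((w + inverse w) / 2)) \<le> N * inverse (cmod w) ^ n"
proof -
  define q where "q = (\<lambda>w::complex. \<Sum>k\<le>n. coeff p k * ((w\<^sup>2 + 1) / 2) ^ k * w ^ (n - k))"
  have p_sum: "poly p z = (\<Sum>k\<le>n. coeff p k * z ^ k)" for z
    unfolding poly_altdef
    by (rule sum.mono_neutral_left) (use deg in \<open>auto intro: coeff_eq_0\<close>)
  have q_eq: "q w = w ^ n * poly p ((w + inverse w) / 2)" if "w \<noteq> 0" for w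
  proof -
    have "((w\<^sup>2 + 1) / 2) ^ k * w ^ (n - k) = w ^ n * ((w + inverse w) / 2) ^ k" if "k \<le> n" for k
    proof -
      have "(w\<^sup>2 + 1) / 2 = w * ((w + inverse w) / 2)"
        using \<open>w \<noteq> 0\<close> by (simp add: field_simps power2_eq_square)
      then have "((w\<^sup>2 + 1) / 2) ^ k * w ^ (n - k) = (w ^ k * w ^ (n - k)) * ((w + inverse w) / 2) ^ k"
        by (simp only: power_mult_distrib mult_ac)
      also have "w ^ k * w ^ (n - k) = w ^ n"
        using that by (simp flip: power_add)
      finally show ?thesis .
    qed
    then show ?thesis
      unfolding q_def p_sum sum_distrib_left
      by (intro sum.cong refl) (simp add: mult.assoc mult.left_commute)
  qed
  have "cmod (q w) \<le> N"
  proof (rule maximum_modulus_frontier[where f = q and \<xi> = w and S = "cball 0 1"])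
    show "q holomorphic_on interior (cball 0 1)"
      unfolding q_def by (intro holomorphic_intros) auto
    show "continuous_on (closure (cball 0 1)) q"
      unfolding q_def by (intro continuous_intros) auto
    fix z assume "z \<in> frontier (cball (0::complex) 1)"
    then have z: "cmod z = 1" by simp
    then have "z \<noteq> 0" by auto
    have "inverse z = cnj z"
      using z complex_norm_square[of z] by (intro inverse_unique) simp
    then have "(z + inverse z) / 2 = of_real (Re z)"
      by (simp add: complex_add_cnj)
    moreover have "Re z \<in> {-1..1}"
      using z abs_Re_le_cmod[of z] by auto
    ultimately show "cmod (q z) \<le> N"
      using q_eq[OF \<open>z \<noteq> 0\<close>] bound z by (simp add: norm_mult norm_power)
  qed (use w in auto)
  then show ?thesis
    using q_eq[OF w(1)] w by (simp add: norm_mult norm_power field_simps)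
qed

text \<open>On an ellipse whose parameter is within \<open>O(1/n)\<close> of \<open>1\<close>, the factor of the preceding
  lemma stays below a constant, as \<open>(1 + 3/n)\<^sup>n \<le> e\<^sup>3\<close>.\<close>

lemma poly_bound_near_interval:
  fixes p :: "complex poly"
  assumes deg: "degree p \<le> n" and n: "n \<ge> 1"
    and bound: "\<And>t. t \<in> {-1..1} \<Longrightarrow> cmod (poly p (of_real t)) \<le> N"
    and z: "cmod (z - 1) + cmod (z + 1) \<le> 2 + 2 / (real n)\<^sup>2"
  shows "cmod (poly p z) \<le> exp 3 * N"
proof -
  obtain w where w: "w \<noteq> 0" "norm w \<le> 1" "z = (w + inverse w) / 2"
    and wz: "cmod (z - 1) + cmod (z + 1) = cmod w + inverse (cmod w)"
    by (rule joukowski_preimage)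
  define \<rho> where "\<rho> = inverse (cmod w)"
  have \<rho>: "\<rho> \<ge> 1"
    using w by (simp add: \<rho>_def one_le_inverse)
  have le: "\<rho> + inverse \<rho> \<le> 2 + 2 / (real n)\<^sup>2"
    using z wz by (simp add: \<rho>_def)
  have n2: "(real n)\<^sup>2 \<ge> 1"
    using n by simp
  have "\<rho> \<le> 4"
  proof -
    have "2 / (real n)\<^sup>2 \<le> 2"
      using n2 by (simp add: divide_le_eq)
    moreover have "inverse \<rho> > 0"
      using \<rho> by simp
    ultimately show ?thesis using le by linarith
  qed
  \<comment> \<open>The parameter exceeds \<open>1\<close> by the square root of the excess of the focal sum over \<open>2\<close>.\<close>
  have "(\<rho> - 1)\<^sup>2 = \<rho> * (\<rho> + inverse \<rho> - 2)"
    using \<rho> by (simp add: field_simps power2_eq_square)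
  also have "\<dots> \<le> 4 * (2 / (real n)\<^sup>2)"
  proof (rule mult_mono)
    show "0 \<le> \<rho> + inverse \<rho> - 2"
    proof -
      have "\<rho> + inverse \<rho> - 2 = (\<rho> - 1)\<^sup>2 / \<rho>"
        using \<rho> by (simp add: field_simps power2_eq_square)
      then show ?thesis using \<rho> by simp
    qed
  qed (use le \<rho> \<open>\<rho> \<le> 4\<close> in auto)
  also have "\<dots> \<le> (3 / real n)\<^sup>2"
    using n2 by (simp add: power_divide divide_right_mono)
  finally have "\<rho> - 1 \<le> 3 / real n"
    using power2_le_imp_le by fastforce
  then have "\<rho> ^ n \<le> (1 + 3 / real n) ^ n"
    using \<rho> by (intro power_mono) auto
  also have "\<dots> \<le> exp 3"
    using exp_ge_one_plus_x_over_n_power_n[of n 3] n by simp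
  finally have "\<rho> ^ n \<le> exp 3" .
  moreover have "N \<ge> 0"
    using bound[of 0] by (smt (verit) atLeastAtMost_iff norm_ge_zero)
  moreover have "cmod (poly p z) \<le> N * \<rho> ^ n"
    unfolding w(3) \<rho>_def using bernstein_walsh[OF deg bound w(1,2)] .
  ultimately show ?thesis
    by (smt (verit) mult.commute mult_left_mono)
qed

text \<open>Cauchy's inequality. The two inequalities below differ only in the radius that keeps the circle about
  \<open>x\<close> inside the ellipse of the preceding lemma.\<close>

lemma norm_pderiv_le_unit:
  fixes p :: "complex poly"
  assumes deg: "degree p \<le> n" and n: "n \<ge> 1"
    and bound: "\<And>t. t \<in> {-1..1} \<Longrightarrow> cmod (poly p (of_real t)) \<le> N"
    and R: "R > 0"
    and near: "\<And>z. cmod (z - of_real x) = R \<Longrightarrow> cmod (z - 1) + cmod (z + 1) \<le> 2 + 2 / (real n)\<^sup>2"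
  shows "cmod (poly (pderiv p) (of_real x)) \<le> exp 3 * N / R"
proof -
  have "cmod ((deriv ^^ 1) (poly p) (of_real x)) \<le> fact 1 * (exp 3 * N) / R ^ 1"
  proof (rule Cauchy_inequality)
    show "cmod (poly p z) \<le> exp 3 * N" if "cmod (of_real x - z) = R" for z
      by (rule poly_bound_near_interval[OF deg n bound near]) (use that in \<open>simp_all add: norm_minus_commute\<close>)
  qed (use R in \<open>auto intro!: holomorphic_intros continuous_intros\<close>)
  moreover have "deriv (poly p) (of_real x) = poly (pderiv p) (of_real x)"
    by (rule DERIV_imp_deriv) (rule poly_DERIV)
  ultimately show ?thesis by simp
qed

text \<open>Within distance \<open>1/n\<^sup>2\<close> of the interval the focal sum grows by at most
  \<open>2/n\<^sup>2\<close>, by the triangle inequality.\<close>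

lemma markov_unit:
  fixes p :: "complex poly"
  assumes deg: "degree p \<le> n" and n: "n \<ge> 1"
    and bound: "\<And>t. t \<in> {-1..1} \<Longrightarrow> cmod (poly p (of_real t)) \<le> N"
    and x: "x \<in> {-1..1}"
  shows "cmod (poly (pderiv p) (of_real x)) \<le> exp 3 * (real n)\<^sup>2 * N"
proof -
  have "cmod (poly (pderiv p) (of_real x)) \<le> exp 3 * N / (1 / (real n)\<^sup>2)"
  proof (rule norm_pderiv_le_unit[OF deg n bound])
    fix z :: complex assume z: "cmod (z - of_real x) = 1 / (real n)\<^sup>2"
    have "cmod (z - 1) \<le> cmod (z - of_real x) + cmod (of_real x - 1)"
      using norm_triangle_ineq[of "z - of_real x" "of_real x - 1"] by simp
    moreover have "cmod (z + 1) \<le> cmod (z - of_real x) + cmod (of_real x + 1)"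
      using norm_triangle_ineq[of "z - of_real x" "of_real x + 1"] by simp
    moreover have "cmod (of_real x - 1) = 1 - x"
    proof -
      have "of_real x - 1 = (of_real (x - 1) :: complex)" by simp
      then show ?thesis using x by (simp only: norm_of_real) auto
    qed
    moreover have "cmod (of_real x + 1) = 1 + x"
    proof -
      have "of_real x + 1 = (of_real (x + 1) :: complex)" by simp
      then show ?thesis using x by (simp only: norm_of_real) auto
    qed
    ultimately show "cmod (z - 1) + cmod (z + 1) \<le> 2 + 2 / (real n)\<^sup>2"
      using z by linarith
  qed (use n in auto)
  then show ?thesis by (simp add: mult_ac)
qed

lemma sqrt_sum_squares_le:
  fixes y v :: real
  assumes "y > 0"
  shows "sqrt (y\<^sup>2 + v\<^sup>2) \<le> y + v\<^sup>2 / (2 * y)"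
proof (rule real_le_lsqrt)
  have "(y + v\<^sup>2 / (2 * y))\<^sup>2 = y\<^sup>2 + v\<^sup>2 + (v\<^sup>2 / (2 * y))\<^sup>2"
    using assms by (simp add: power2_sum)
  then show "y\<^sup>2 + v\<^sup>2 \<le> (y + v\<^sup>2 / (2 * y))\<^sup>2" by simp
qed (use assms in auto)

text \<open>Away from the foci the focal sum grows only quadratically with the distance from the interval, so a
  disc of radius of order \<open>1/n\<close> is admissible.\<close>

lemma bernstein_unit:
  fixes p :: "complex poly"
  assumes deg: "degree p \<le> n" and n: "n \<ge> 1"
    and bound: "\<And>t. t \<in> {-1..1} \<Longrightarrow> cmod (poly p (of_real t)) \<le> N"
    and a: "a < 1" and x: "x \<in> {-a..a}"
  shows "cmod (poly (pderiv p) (of_real x)) \<le> exp 3 * (2 / (1 - a)) * real n * N"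
proof -
  define \<delta> where "\<delta> = (1 - a) / 2"
  have \<delta>: "\<delta> > 0" "\<delta> \<le> 1/2" using a x by (auto simp: \<delta>_def)
  have "cmod (poly (pderiv p) (of_real x)) \<le> exp 3 * N / (\<delta> / real n)"
  proof (rule norm_pderiv_le_unit[OF deg n bound])
    fix z :: complex assume z: "cmod (z - of_real x) = \<delta> / real n"
    define X v where "X = Re z" and "v = Im z"
    have "\<bar>v\<bar> \<le> \<delta> / real n" "\<bar>X - x\<bar> \<le> \<delta> / real n"
      using abs_Im_le_cmod[of "z - of_real x"] abs_Re_le_cmod[of "z - of_real x"] z
      by (auto simp: X_def v_def)
    moreover have "\<delta> / real n \<le> \<delta>"
      using n \<delta> by (simp add: divide_le_eq)
    moreover have "a = 1 - 2 * \<delta>"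
      by (simp add: \<delta>_def field_simps)
    ultimately have X: "1 - X \<ge> \<delta>" "1 + X \<ge> \<delta>"
      using x by (auto simp: abs_le_iff)
    have v2: "v\<^sup>2 \<le> (\<delta> / real n)\<^sup>2"
      using \<open>\<bar>v\<bar> \<le> \<delta> / real n\<close> by (metis abs_ge_zero power2_abs power_mono)
    have small: "v\<^sup>2 / (2 * y) \<le> 1 / (real n)\<^sup>2" if "y \<ge> \<delta>" for y
    proof -
      have "v\<^sup>2 / (2 * y) \<le> (\<delta> / real n)\<^sup>2 / (2 * \<delta>)"
        using v2 that \<delta> by (intro frac_le) auto
      also have "\<dots> = (\<delta> / 2) / (real n)\<^sup>2"
        using \<delta> by (simp add: power_divide power2_eq_square)
      also have "\<dots> \<le> 1 / (real n)\<^sup>2"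
        using \<delta> by (intro divide_right_mono) auto
      finally show ?thesis .
    qed
    have "cmod (z - 1) = sqrt ((1 - X)\<^sup>2 + v\<^sup>2)"
      by (simp add: cmod_def X_def v_def power2_commute)
    also have "\<dots> \<le> (1 - X) + v\<^sup>2 / (2 * (1 - X))"
      using X \<delta> by (intro sqrt_sum_squares_le) auto
    finally have 1: "cmod (z - 1) \<le> (1 - X) + 1 / (real n)\<^sup>2"
      using small[OF X(1)] by linarith
    have "cmod (z + 1) = sqrt ((1 + X)\<^sup>2 + v\<^sup>2)"
      by (simp add: cmod_def X_def v_def add.commute)
    also have "\<dots> \<le> (1 + X) + v\<^sup>2 / (2 * (1 + X))"
      using X \<delta> by (intro sqrt_sum_squares_le) auto
    finally have 2: "cmod (z + 1) \<le> (1 + X) + 1 / (real n)\<^sup>2"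
      using small[OF X(2)] by linarith
    show "cmod (z - 1) + cmod (z + 1) \<le> 2 + 2 / (real n)\<^sup>2"
      using 1 2 by linarith
  qed (use n \<delta> in auto)
  then show ?thesis using a by (simp add: \<delta>_def mult_ac)
qed

text \<open>The common form of the two inequalities: \<open>k\<close>-fold differentiation of polynomials of degree at most
  \<open>n\<close> is bounded by a multiple of \<open>n\<^sup>s\<close>, from the uniform norm on \<open>[-b, b]\<close> to
  the one on \<open>[-a, a]\<close>. The Markov inequality has \<open>a = b\<close> and \<open>s = 2k\<close>, the
  Bernstein inequality \<open>a < b\<close> and \<open>s = k\<close>.\<close>

definition derivative_growth :: "real \<Rightarrow> real \<Rightarrow> nat \<Rightarrow> nat \<Rightarrow> bool" where
  "derivative_growth a b k s \<longleftrightarrow>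
     (\<exists>C\<ge>0. \<forall>n\<ge>1. \<forall>p :: complex poly. \<forall>N. degree p \<le> n \<longrightarrow>
        (\<forall>t\<in>{-b..b}. cmod (poly p (of_real t)) \<le> N) \<longrightarrow>
        (\<forall>t\<in>{-a..a}. cmod (poly ((pderiv ^^ k) p) (of_real t)) \<le> C * real n ^ s * N))"

lemma derivative_growth_rescale:
  assumes "b > 0" "derivative_growth (a / b) 1 1 s"
  shows "derivative_growth a b 1 s"
proof -
  obtain C where C: "C \<ge> 0" "\<And>n p N t. n \<ge> 1 \<Longrightarrow> degree p \<le> n \<Longrightarrow>
      (\<And>t. t\<in>{-1..1} \<Longrightarrow> cmod (poly p (of_real t)) \<le> N) \<Longrightarrow> t \<in> {-(a/b)..a/b} \<Longrightarrow>
      cmod (poly (pderiv p) (of_real t)) \<le> C * real n ^ s * N"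
    using assms(2) unfolding derivative_growth_def by auto
  have "cmod (poly (pderiv p) (of_real t)) \<le> C / b * real n ^ s * N"
    if n: "n \<ge> 1" and p: "degree p \<le> n" and t: "t \<in> {-a..a}"
      and N: "\<And>t. t\<in>{-b..b} \<Longrightarrow> cmod (poly p (of_real t)) \<le> N" for n p N t
  proof -
    define q where "q = pcompose p [:0, of_real b:]"
    have "degree q \<le> n"
      using p assms(1) by (simp add: q_def degree_pcompose)
    moreover have "cmod (poly q (of_real t)) \<le> N" if "t \<in> {-1..1}" for t
    proof -
      have "t * b \<in> {-b..b}"
        using that assms(1) mult_right_mono[of t 1 b] mult_right_mono[of "-1" t b] by auto
      from N[OF this] show ?thesis by (simp add: q_def poly_pcompose)
    qed
    moreover have "t / b \<in> {-(a/b)..a/b}"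
      using t assms(1) by (auto simp: field_simps)
    ultimately have "cmod (poly (pderiv q) (of_real (t / b))) \<le> C * real n ^ s * N"
      using C(2)[OF n] by blast
    moreover have "poly (pderiv q) (of_real (t / b)) = poly (pderiv p) (of_real t) * of_real b"
      using assms(1) by (simp add: q_def pderiv_pcompose poly_pcompose pderiv_pCons)
    ultimately show ?thesis
      using assms(1) by (simp add: norm_mult field_simps)
  qed
  moreover have "C / b \<ge> 0" using C(1) assms(1) by simp
  ultimately show ?thesis
    unfolding derivative_growth_def by (intro exI[of _ "C / b"]) auto
qed

lemma markov:
  assumes "b > 0"
  shows "derivative_growth b b 1 2"
proof (rule derivative_growth_rescale[OF assms])
  show "derivative_growth (b / b) 1 1 2"
    unfolding derivative_growth_def
    using assms by (intro exI[of _ "exp 3"] conjI allI impI ballI) (auto intro!: markov_unit)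
qed

lemma bernstein:
  assumes "a < b" "b > 0"
  shows "derivative_growth a b 1 1"
proof (rule derivative_growth_rescale[OF assms(2)])
  have "a / b < 1" using assms by simp
  then show "derivative_growth (a / b) 1 1 1"
    using bernstein_unit[where a = "a / b"] unfolding derivative_growth_def
    by (intro exI[of _ "exp 3 * (2 / (1 - a / b))"] conjI allI impI ballI) simp_all
qed

lemma derivative_growth_0: "a \<le> b \<Longrightarrow> derivative_growth a b 0 0"
  unfolding derivative_growth_def by (intro exI[of _ 1]) auto

lemma derivative_growth_compose:
  assumes "derivative_growth a c 1 s" "derivative_growth c b k t"
  shows "derivative_growth a b (Suc k) (s + t)"
proof -
  obtain C where C: "C \<ge> 0" "\<And>n p N x. n \<ge> 1 \<Longrightarrow> degree p \<le> n \<Longrightarrow>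
      (\<And>t. t\<in>{-c..c} \<Longrightarrow> cmod (poly p (of_real t)) \<le> N) \<Longrightarrow> x \<in> {-a..a} \<Longrightarrow>
      cmod (poly (pderiv p) (of_real x)) \<le> C * real n ^ s * N"
    using assms(1) unfolding derivative_growth_def by auto
  obtain D where D: "D \<ge> 0" "\<And>n p N x. n \<ge> 1 \<Longrightarrow> degree p \<le> n \<Longrightarrow>
      (\<And>t. t\<in>{-b..b} \<Longrightarrow> cmod (poly p (of_real t)) \<le> N) \<Longrightarrow> x \<in> {-c..c} \<Longrightarrow>
      cmod (poly ((pderiv ^^ k) p) (of_real x)) \<le> D * real n ^ t * N"
    using assms(2) unfolding derivative_growth_def by auto
  have "cmod (poly ((pderiv ^^ Suc k) p) (of_real x)) \<le> (C * D) * real n ^ (s + t) * N"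
    if "n \<ge> 1" "degree p \<le> n" "\<And>t. t\<in>{-b..b} \<Longrightarrow> cmod (poly p (of_real t)) \<le> N" "x \<in> {-a..a}"
    for n p N x
  proof -
    have "cmod (poly (pderiv ((pderiv ^^ k) p)) (of_real x)) \<le> C * real n ^ s * (D * real n ^ t * N)"
      by (rule C(2)[OF that(1) _ _ that(4)])
         (use that in \<open>auto simp: degree_higher_pderiv intro!: D(2)\<close>)
    then show ?thesis by (simp add: power_add mult_ac)
  qed
  then show ?thesis
    using C(1) D(1) unfolding derivative_growth_def
    by (intro exI[of _ "C * D"]) auto
qed

lemma derivative_growth_endpoints:
  assumes "b > 0"
  shows "derivative_growth b b k (2 * k)"
proof (induction k)
  case (Suc k)
  then show ?case
    using derivative_growth_compose[OF markov[OF assms] Suc.IH] by simp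
qed (simp add: derivative_growth_0)

lemma derivative_growth_interior:
  assumes "a < b" "b > 0"
  shows "derivative_growth a b k k"
  using assms(1)
proof (induction k arbitrary: a)
  case (Suc k)
  \<comment> \<open>Each differentiation shrinks the interval a little; \<open>max\<close> keeps the intermediate interval nontrivial when \<open>a\<close> is negative.\<close>
  define c where "c = (max a 0 + b) / 2"
  have c: "a < c" "c > 0" "c < b"
    using Suc.prems assms(2) by (auto simp: c_def max_def)
  show ?case
    using derivative_growth_compose[OF bernstein[OF c(1,2)] Suc.IH[OF c(3)]] by simp
qed (simp add: derivative_growth_0)

section \<open>Comparison of a polynomial with its image\<close>

text \<open>Integration along one characteristic. The function \<open>\<mu>/2 exp(2K\<sigma>)\<close> is a primitive of the bound on
  the derivative. The rate \<open>2K\<close>, twice what the Gronwall inequality would give, is chosen so that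
  the factor \<open>1/2\<close> appears.\<close>

lemma characteristic_step:
  fixes u :: "real \<Rightarrow> complex"
  assumes "\<tau> \<ge> 0" "K > 0" "\<mu> \<ge> 0"
    and cont: "continuous_on {0..\<tau>} u"
    and deriv: "\<And>\<sigma>. 0 < \<sigma> \<Longrightarrow> \<sigma> < \<tau> \<Longrightarrow> (u has_vector_derivative d \<sigma>) (at \<sigma>)"
    and bound: "\<And>\<sigma>. 0 < \<sigma> \<Longrightarrow> \<sigma> < \<tau> \<Longrightarrow> cmod (d \<sigma>) \<le> K * (\<mu> * exp (2 * K * \<sigma>))"
    and init: "cmod (u 0) \<le> N"
  shows "cmod (u \<tau>) \<le> N + \<mu> / 2 * exp (2 * K * \<tau>)"
proof (cases "\<tau> = 0")
  case True
  then show ?thesis using init \<open>\<mu> \<ge> 0\<close> by simp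
next
  case False
  have "norm (u \<tau> - u 0) \<le> \<mu> / 2 * exp (2 * K * \<tau>) - \<mu> / 2 * exp (2 * K * 0)"
  proof (rule differentiable_bound_general[where f = u and f' = d
        and \<phi> = "\<lambda>\<sigma>. \<mu> / 2 * exp (2 * K * \<sigma>)" and \<phi>' = "\<lambda>\<sigma>. K * (\<mu> * exp (2 * K * \<sigma>))"])
    show "((\<lambda>\<sigma>. \<mu> / 2 * exp (2 * K * \<sigma>)) has_vector_derivative K * (\<mu> * exp (2 * K * \<sigma>))) (at \<sigma>)"
      for \<sigma>
      unfolding has_real_derivative_iff_has_vector_derivative[symmetric]
      by (auto intro!: derivative_eq_intros)
  qed (use assms False in \<open>auto intro!: continuous_intros\<close>)
  moreover have "cmod (u \<tau>) \<le> cmod (u 0) + norm (u \<tau> - u 0)"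
    by (metis add.commute diff_add_cancel norm_triangle_ineq)
  ultimately show ?thesis
    using init \<open>\<mu> \<ge> 0\<close> by simp
qed

text \<open>The part in \<open>\<tau> \<ge> 0\<close> of the domain of determinacy of the segment \<open>[-a, a]\<close> for waves of
  speed one.\<close>

definition triangle :: "real \<Rightarrow> (real \<times> real) set" where
  "triangle a = {z. 0 \<le> fst z \<and> \<bar>snd z\<bar> \<le> a - fst z}"

text \<open>An a priori bound for \<open>A\<^sub>\<tau> - A\<^sub>\<xi> = c B\<close>,
  \<open>B\<^sub>\<tau> + B\<^sub>\<xi> = d A\<close> with \<open>\<bar>c\<bar>, \<bar>d\<bar> \<le> K\<close>.
  Let \<open>\<mu>\<close> be the maximum over the triangle of \<open>exp(-2K\<tau>) max(\<bar>A\<bar>, \<bar>B\<bar>)\<close>.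
  Integration along the characteristic that ends at a maximum point gives
  \<open>\<mu> \<le> N + \<mu>/2\<close>.\<close>

lemma hyperbolic_system_bound:
  fixes A B dA dB :: "real \<Rightarrow> real \<Rightarrow> complex"
  assumes K: "K > 0"
    and contA: "continuous_on (triangle a) (\<lambda>z. A (fst z) (snd z))"
    and contB: "continuous_on (triangle a) (\<lambda>z. B (fst z) (snd z))"
    and dA: "\<And>\<tau> \<xi>. 0 < \<tau> \<Longrightarrow> \<tau> < a \<Longrightarrow> \<bar>\<xi>\<bar> \<le> a - \<tau> \<Longrightarrow>
       ((\<lambda>\<sigma>. A \<sigma> (\<xi> + \<tau> - \<sigma>)) has_vector_derivative dA \<tau> \<xi>) (at \<tau>)"
    and dB: "\<And>\<tau> \<xi>. 0 < \<tau> \<Longrightarrow> \<tau> < a \<Longrightarrow> \<bar>\<xi>\<bar> \<le> a - \<tau> \<Longrightarrow>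
       ((\<lambda>\<sigma>. B \<sigma> (\<xi> - \<tau> + \<sigma>)) has_vector_derivative dB \<tau> \<xi>) (at \<tau>)"
    and dA_le: "\<And>\<tau> \<xi>. 0 < \<tau> \<Longrightarrow> \<tau> < a \<Longrightarrow> \<bar>\<xi>\<bar> \<le> a - \<tau> \<Longrightarrow> cmod (dA \<tau> \<xi>) \<le> K * cmod (B \<tau> \<xi>)"
    and dB_le: "\<And>\<tau> \<xi>. 0 < \<tau> \<Longrightarrow> \<tau> < a \<Longrightarrow> \<bar>\<xi>\<bar> \<le> a - \<tau> \<Longrightarrow> cmod (dB \<tau> \<xi>) \<le> K * cmod (A \<tau> \<xi>)"
    and initA: "\<And>\<xi>. \<bar>\<xi>\<bar> \<le> a \<Longrightarrow> cmod (A 0 \<xi>) \<le> N"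
    and initB: "\<And>\<xi>. \<bar>\<xi>\<bar> \<le> a \<Longrightarrow> cmod (B 0 \<xi>) \<le> N"
    and pt: "0 \<le> \<tau>" "\<bar>\<xi>\<bar> \<le> a - \<tau>"
  shows "cmod (A \<tau> \<xi>) \<le> 2 * N * exp (2 * K * \<tau>) \<and> cmod (B \<tau> \<xi>) \<le> 2 * N * exp (2 * K * \<tau>)"
proof -
  define w where "w = (\<lambda>z. exp (- (2 * K * fst z)) *
     max (cmod (A (fst z) (snd z))) (cmod (B (fst z) (snd z))))"
  have "compact (triangle a)"
  proof -
    have "triangle a = {z. 0 \<le> fst z} \<inter> {z. \<bar>snd z\<bar> \<le> a - fst z}"
      by (auto simp: triangle_def)
    moreover have "closed \<dots>"
      by (intro closed_Int closed_Collect_le continuous_intros)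
    moreover have "triangle a \<subseteq> cbox (0, -a) (a, a)"
      by (auto simp: triangle_def cbox_Pair_eq)
    ultimately show ?thesis
      by (metis bounded_cbox bounded_subset compact_eq_bounded_closed)
  qed
  moreover have "triangle a \<noteq> {}"
    using pt by (auto simp: triangle_def)
  moreover have "continuous_on (triangle a) w"
    unfolding w_def by (intro continuous_intros contA contB)
  ultimately obtain z where z: "z \<in> triangle a" "\<And>y. y \<in> triangle a \<Longrightarrow> w y \<le> w z"
    using continuous_attains_sup[of "triangle a" w] by auto
  obtain \<tau>0 \<xi>0 where z_eq: "z = (\<tau>0, \<xi>0)" by fastforce
  have pt0: "0 \<le> \<tau>0" "\<bar>\<xi>0\<bar> \<le> a - \<tau>0"
    using z(1) by (auto simp: z_eq triangle_def)
  define \<mu> where "\<mu> = w z"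
  have "\<mu> \<ge> 0" by (simp add: \<mu>_def w_def le_max_iff_disj)
  have "cmod (A \<tau> \<xi>) \<le> \<mu> * exp (2 * K * \<tau>) \<and> cmod (B \<tau> \<xi>) \<le> \<mu> * exp (2 * K * \<tau>)"
    if "0 \<le> \<tau>" "\<bar>\<xi>\<bar> \<le> a - \<tau>" for \<tau> \<xi>
  proof -
    have "w (\<tau>, \<xi>) \<le> \<mu>"
      using that z(2) by (simp add: \<mu>_def triangle_def)
    then have "max (cmod (A \<tau> \<xi>)) (cmod (B \<tau> \<xi>)) \<le> \<mu> * exp (2 * K * \<tau>)"
      by (simp add: w_def exp_minus field_simps)
    then show ?thesis by simp
  qed
  note le = this[THEN conjunct1] this[THEN conjunct2]
  have A0: "cmod (A \<tau>0 (\<xi>0 + \<tau>0 - \<tau>0)) \<le> N + \<mu> / 2 * exp (2 * K * \<tau>0)"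
  proof (rule characteristic_step[where u = "\<lambda>\<sigma>. A \<sigma> (\<xi>0 + \<tau>0 - \<sigma>)" and \<tau> = \<tau>0
        and d = "\<lambda>\<sigma>. dA \<sigma> (\<xi>0 + \<tau>0 - \<sigma>)"])
    have "continuous_on {0..\<tau>0} (\<lambda>\<sigma>. (\<lambda>z. A (fst z) (snd z)) (\<sigma>, \<xi>0 + \<tau>0 - \<sigma>))"
      by (rule continuous_on_compose2[OF contA, of "{0..\<tau>0}" "\<lambda>\<sigma>. (\<sigma>, \<xi>0 + \<tau>0 - \<sigma>)"])
         (use pt0 in \<open>auto simp: triangle_def intro!: continuous_intros\<close>)
    then show "continuous_on {0..\<tau>0} (\<lambda>\<sigma>. A \<sigma> (\<xi>0 + \<tau>0 - \<sigma>))"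
      by simp
    fix \<sigma> assume \<sigma>: "0 < \<sigma>" "\<sigma> < \<tau>0"
    show "((\<lambda>\<sigma>. A \<sigma> (\<xi>0 + \<tau>0 - \<sigma>)) has_vector_derivative dA \<sigma> (\<xi>0 + \<tau>0 - \<sigma>)) (at \<sigma>)"
      using dA[of \<sigma> "\<xi>0 + \<tau>0 - \<sigma>"] \<sigma> pt0 by auto
    show "cmod (dA \<sigma> (\<xi>0 + \<tau>0 - \<sigma>)) \<le> K * (\<mu> * exp (2 * K * \<sigma>))"
      using dA_le[of \<sigma> "\<xi>0 + \<tau>0 - \<sigma>"] le(2)[of \<sigma> "\<xi>0 + \<tau>0 - \<sigma>"] \<sigma> pt0 K
      by (smt (verit) mult_left_mono)
  qed (use K pt0 \<open>\<mu> \<ge> 0\<close> initA in auto)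
  have B0: "cmod (B \<tau>0 (\<xi>0 - \<tau>0 + \<tau>0)) \<le> N + \<mu> / 2 * exp (2 * K * \<tau>0)"
  proof (rule characteristic_step[where u = "\<lambda>\<sigma>. B \<sigma> (\<xi>0 - \<tau>0 + \<sigma>)" and \<tau> = \<tau>0
        and d = "\<lambda>\<sigma>. dB \<sigma> (\<xi>0 - \<tau>0 + \<sigma>)"])
    have "continuous_on {0..\<tau>0} (\<lambda>\<sigma>. (\<lambda>z. B (fst z) (snd z)) (\<sigma>, \<xi>0 - \<tau>0 + \<sigma>))"
      by (rule continuous_on_compose2[OF contB, of "{0..\<tau>0}" "\<lambda>\<sigma>. (\<sigma>, \<xi>0 - \<tau>0 + \<sigma>)"])
         (use pt0 in \<open>auto simp: triangle_def intro!: continuous_intros\<close>)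
    then show "continuous_on {0..\<tau>0} (\<lambda>\<sigma>. B \<sigma> (\<xi>0 - \<tau>0 + \<sigma>))"
      by simp
    fix \<sigma> assume \<sigma>: "0 < \<sigma>" "\<sigma> < \<tau>0"
    show "((\<lambda>\<sigma>. B \<sigma> (\<xi>0 - \<tau>0 + \<sigma>)) has_vector_derivative dB \<sigma> (\<xi>0 - \<tau>0 + \<sigma>)) (at \<sigma>)"
      using dB[of \<sigma> "\<xi>0 - \<tau>0 + \<sigma>"] \<sigma> pt0 by auto
    show "cmod (dB \<sigma> (\<xi>0 - \<tau>0 + \<sigma>)) \<le> K * (\<mu> * exp (2 * K * \<sigma>))"
      using dB_le[of \<sigma> "\<xi>0 - \<tau>0 + \<sigma>"] le(1)[of \<sigma> "\<xi>0 - \<tau>0 + \<sigma>"] \<sigma> pt0 K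
      by (smt (verit) mult_left_mono)
  qed (use K pt0 \<open>\<mu> \<ge> 0\<close> initB in auto)
  have "N \<ge> 0"
    using initA[of 0] pt0 by (smt (verit) abs_zero norm_ge_zero)
  have "\<mu> * exp (2 * K * \<tau>0) = max (cmod (A \<tau>0 \<xi>0)) (cmod (B \<tau>0 \<xi>0))"
    by (simp add: \<mu>_def w_def z_eq exp_minus)
  also have "\<dots> \<le> N + \<mu> / 2 * exp (2 * K * \<tau>0)"
    using A0 B0 by simp
  finally have "\<mu> * exp (2 * K * \<tau>0) \<le> 2 * N" by simp
  moreover have "exp (2 * K * \<tau>0) \<ge> 1"
    using K pt0 by simp
  ultimately have "\<mu> \<le> 2 * N"
    using \<open>\<mu> \<ge> 0\<close> by (smt (verit) mult_le_cancel_left1)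
  then have "\<mu> * exp (2 * K * \<tau>) \<le> 2 * N * exp (2 * K * \<tau>)"
    by (intro mult_right_mono) auto
  then show ?thesis
    using le[OF pt] by (meson order_trans)
qed

text \<open>The coefficient of \<open>x\<^sup>k\<close> in \<open>p(x + t)\<close>.\<close>

definition taylor_coeff :: "complex poly \<Rightarrow> nat \<Rightarrow> real \<Rightarrow> complex" where
  "taylor_coeff p k t = poly ((pderiv ^^ k) p) (of_real t) / fact k"

text \<open>The image of the translate \<open>p(\<cdot> + t)\<close> under the linear map that replaces \<open>x\<^sup>k\<close> by
  \<open>\<eta>\<^sub>k\<close>.\<close>

definition family_translate :: "(nat \<Rightarrow> real \<Rightarrow> complex) \<Rightarrow> complex poly \<Rightarrow> real \<Rightarrow> real \<Rightarrow> complex" where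
  "family_translate \<eta> p x t = (\<Sum>k\<le>degree p. \<eta> k x * taylor_coeff p k t)"

text \<open>The map \<open>T\<close> that replaces \<open>x\<^sup>k\<close> by \<open>\<phi>\<^sub>k\<close>.\<close>

definition poly_map :: "(nat \<Rightarrow> real \<Rightarrow> complex) \<Rightarrow> complex poly \<Rightarrow> real \<Rightarrow> complex" where
  "poly_map \<phi> p x = (\<Sum>k\<le>degree p. coeff p k * \<phi> k x)"

lemma poly_map_eq_sum:
  assumes "degree p \<le> n"
  shows "poly_map \<phi> p x = (\<Sum>k\<le>n. coeff p k * \<phi> k x)"
  unfolding poly_map_def by (rule sum.mono_neutral_left) (use assms in \<open>auto intro: coeff_eq_0\<close>)

lemma poly_map_diff: "poly_map \<phi> (p - q) x = poly_map \<phi> p x - poly_map \<phi> q x"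
proof -
  let ?n = "max (degree p) (degree q)"
  have "degree (p - q) \<le> ?n" by (rule degree_diff_le_max)
  then show ?thesis
    by (simp add: poly_map_eq_sum[where n = ?n] left_diff_distrib sum_subtractf)
qed

lemma taylor_coeff_deriv:
  "((\<lambda>t. taylor_coeff p k t) has_vector_derivative of_nat (Suc k) * taylor_coeff p (Suc k) t) (at t within S)"
proof -
  have "((\<lambda>t. poly ((pderiv ^^ k) p) (of_real t)) has_vector_derivative
      poly (pderiv ((pderiv ^^ k) p)) (of_real t)) (at t within S)"
    by (rule has_vector_derivative_real_field) (rule poly_DERIV)
  from has_vector_derivative_mult_left[OF this, of "inverse (fact k)"] show ?thesis
    by (simp add: taylor_coeff_def divide_inverse mult_ac del: of_nat_Suc)
       (simp add: mult.assoc[symmetric] del: of_nat_Suc)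
qed

lemma taylor_coeff_0: "taylor_coeff p k 0 = coeff p k"
  by (simp add: taylor_coeff_def poly_0_coeff_0 coeff_higher_pderiv flip: pochhammer_fact)

lemma taylor_coeff_Suc_degree: "taylor_coeff p (Suc (degree p)) t = 0"
proof -
  have "coeff ((pderiv ^^ Suc (degree p)) p) i = 0" for i
    by (simp only: coeff_higher_pderiv) (simp add: coeff_eq_0)
  then have "(pderiv ^^ Suc (degree p)) p = 0"
    by (intro poly_eqI) simp
  then show ?thesis by (simp only: taylor_coeff_def poly_0 div_0)
qed

text \<open>If \<open>\<eta>\<^sub>k' = \<kappa> \<omega>\<^sub>k + e k \<eta>\<^sub>k\<^sub>-\<^sub>1\<close>, then the term with
  \<open>\<eta>\<^sub>k\<^sub>-\<^sub>1\<close> is \<open>e\<close> times the image of the derivative of the translate, which equals its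
  derivative in \<open>t\<close>. Along the line \<open>t = c - e x\<close> these two contributions cancel and only
  the term with \<open>\<kappa>\<close> is left.\<close>

lemma family_translate_characteristic:
  fixes e :: real and \<eta> \<omega> :: "nat \<Rightarrow> real \<Rightarrow> complex"
  assumes "\<And>k. (\<eta> k has_vector_derivative \<kappa> * \<omega> k x + of_real e * of_nat k * \<eta> (k - 1) x) (at x within S)"
  shows "((\<lambda>\<sigma>. family_translate \<eta> p \<sigma> (c - e * \<sigma>)) has_vector_derivative
           \<kappa> * family_translate \<omega> p x (c - e * x)) (at x within S)"
proof -
  define n where "n = degree p"
  let ?p = "\<lambda>k. taylor_coeff p k (c - e * x)"
  have lin: "((\<lambda>\<sigma>. c - e * \<sigma>) has_vector_derivative - e) (at x within S)"
    by (auto intro!: derivative_eq_intros)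
  have p: "((\<lambda>\<sigma>. taylor_coeff p k (c - e * \<sigma>)) has_vector_derivative
       - e * (of_nat (Suc k) * ?p (Suc k))) (at x within S)" for k
    using vector_diff_chain_within[OF lin taylor_coeff_deriv[of p k]]
    by (simp add: o_def scaleR_conv_of_real)
  have "((\<lambda>\<sigma>. family_translate \<eta> p \<sigma> (c - e * \<sigma>)) has_vector_derivative
      (\<Sum>k\<le>n. \<eta> k x * (- e * (of_nat (Suc k) * ?p (Suc k))) +
         (\<kappa> * \<omega> k x + of_real e * of_nat k * \<eta> (k - 1) x) * ?p k)) (at x within S)"
    unfolding family_translate_def n_def[symmetric]
    by (intro has_vector_derivative_sum has_vector_derivative_mult assms p)
  moreover have "(\<Sum>k\<le>n. \<eta> k x * (- e * (of_nat (Suc k) * ?p (Suc k))) +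
         (\<kappa> * \<omega> k x + of_real e * of_nat k * \<eta> (k - 1) x) * ?p k)
     = \<kappa> * (\<Sum>k\<le>n. \<omega> k x * ?p k) + e * ((\<Sum>k\<le>n. of_nat k * \<eta> (k - 1) x * ?p k)
         - (\<Sum>k\<le>n. of_nat (Suc k) * \<eta> k x * ?p (Suc k)))"
  proof -
    have "\<eta> k x * (- e * (of_nat (Suc k) * ?p (Suc k))) +
         (\<kappa> * \<omega> k x + of_real e * of_nat k * \<eta> (k - 1) x) * ?p k
      = \<kappa> * (\<omega> k x * ?p k) + e * (of_nat k * \<eta> (k - 1) x * ?p k - of_nat (Suc k) * \<eta> k x * ?p (Suc k))" for k
      by (simp add: algebra_simps)
    then show ?thesis
      by (simp only: sum.distrib sum_subtractf sum_distrib_left[symmetric])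
  qed
  moreover have "(\<Sum>k\<le>n. of_nat k * \<eta> (k - 1) x * ?p k)
      = (\<Sum>k\<le>n. of_nat (Suc k) * \<eta> k x * ?p (Suc k))"
  proof -
    have "(\<Sum>k\<le>n. of_nat k * \<eta> (k - 1) x * ?p k) = (\<Sum>k\<le>Suc n. of_nat k * \<eta> (k - 1) x * ?p k)"
      by (simp add: n_def taylor_coeff_Suc_degree)
    also have "\<dots> = (\<Sum>k\<le>n. of_nat (Suc k) * \<eta> k x * ?p (Suc k))"
      by (subst sum.atMost_Suc_shift) simp
    finally show ?thesis .
  qed
  ultimately show ?thesis
    by (simp add: family_translate_def n_def)
qed

text \<open>Two families that behave like the powers \<open>x\<^sup>k\<close> except for a zero-order term: up to this term,
  differentiation lowers the index and passes from one family to the other. For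
  \<open>\<kappa> = f'/f\<close> this holds for the \<open>\<phi>\<^sub>k\<close> built from \<open>f\<close> and those built
  from \<open>1/f\<close>. For \<open>k = 0\<close> the truncated index \<open>k - 1\<close> is harmless because of the
  factor \<open>k\<close>.\<close>

locale transmutation =
  fixes \<phi> \<psi> :: "nat \<Rightarrow> real \<Rightarrow> complex" and \<kappa> :: "real \<Rightarrow> complex" and b K :: real
  assumes b_pos: "b > 0" and K_pos: "K > 0"
    and \<kappa>_le: "\<And>x. x \<in> {-b..b} \<Longrightarrow> cmod (\<kappa> x) \<le> K"
    and \<phi>_deriv: "\<And>k x. x \<in> {-b..b} \<Longrightarrow>
      (\<phi> k has_vector_derivative \<kappa> x * \<phi> k x + of_nat k * \<psi> (k - 1) x) (at x within {-b..b})"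
    and \<psi>_deriv: "\<And>k x. x \<in> {-b..b} \<Longrightarrow>
      (\<psi> k has_vector_derivative - \<kappa> x * \<psi> k x + of_nat k * \<phi> (k - 1) x) (at x within {-b..b})"
    and \<phi>_0: "\<And>k. \<phi> k 0 = (if k = 0 then 1 else 0)"
    and \<psi>_0: "\<And>k. \<psi> k 0 = (if k = 0 then 1 else 0)"
begin

lemma norm_\<kappa>_mult: "\<bar>x\<bar> \<le> b \<Longrightarrow> cmod (\<kappa> x * z) \<le> K * cmod z"
  using \<kappa>_le[of x] by (simp add: norm_mult mult_right_mono abs_le_iff)

lemma swap: "transmutation \<psi> \<phi> (\<lambda>x. - \<kappa> x) b K"
  by unfold_locales (use b_pos K_pos \<kappa>_le \<phi>_deriv \<psi>_deriv \<phi>_0 \<psi>_0 in auto)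

lemma poly_map_deriv:
  assumes x: "x \<in> {-b..b}"
  shows "(poly_map \<phi> p has_vector_derivative
     \<kappa> x * poly_map \<phi> p x + poly_map \<psi> (pderiv p) x) (at x within {-b..b})"
proof -
  define n where "n = degree p"
  have "(poly_map \<phi> p has_vector_derivative
     (\<Sum>k\<le>n. coeff p k * (\<kappa> x * \<phi> k x + of_nat k * \<psi> (k - 1) x))) (at x within {-b..b})"
    unfolding poly_map_def[abs_def] n_def
    by (intro has_vector_derivative_sum has_vector_derivative_mult_right \<phi>_deriv x)
  moreover have "(\<Sum>k\<le>n. coeff p k * (of_nat k * \<psi> (k - 1) x)) = poly_map \<psi> (pderiv p) x"
  proof -
    have "(\<Sum>k\<le>n. coeff p k * (of_nat k * \<psi> (k - 1) x)) = (\<Sum>k\<le>Suc n. coeff p k * (of_nat k * \<psi> (k - 1) x))"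
      by (simp add: n_def coeff_eq_0)
    also have "\<dots> = (\<Sum>k\<le>n. coeff (pderiv p) k * \<psi> k x)"
      by (subst sum.atMost_Suc_shift) (simp add: coeff_pderiv mult_ac)
    also have "\<dots> = poly_map \<psi> (pderiv p) x"
      by (rule poly_map_eq_sum[symmetric]) (simp add: n_def degree_pderiv)
    finally show ?thesis .
  qed
  ultimately show ?thesis
    by (simp add: poly_map_def[of \<phi>] n_def[symmetric] distrib_left sum.distrib sum_distrib_left mult_ac)
qed

text \<open>With \<open>u = 1/f\<close> this is the first step \<open>(T p / f)' = T' (p') / f\<close> of the
  \<open>f\<close>-differentiation; in the swapped situation \<open>u = f\<close> gives the second one.\<close>

lemma integrating_factor_deriv:
  assumes "x \<in> {-b..b}" and u: "(u has_vector_derivative - \<kappa> x * u x) (at x within {-b..b})"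
  shows "((\<lambda>s. u s * poly_map \<phi> p s) has_vector_derivative u x * poly_map \<psi> (pderiv p) x)
           (at x within {-b..b})"
  by (rule has_vector_derivative_eq_rhs[OF has_vector_derivative_mult[OF u poly_map_deriv]])
     (use assms in \<open>simp_all add: algebra_simps\<close>)

text \<open>The functions \<open>A = W + V\<close> and \<open>B = W - V\<close> of \<open>(x, t)\<close>, where \<open>W\<close> and
  \<open>V\<close> are the images of \<open>p(\<cdot> + t)\<close> under the maps belonging to \<open>\<phi>\<close> and
  \<open>\<psi>\<close>.\<close>

definition "wave_sum p = family_translate (\<lambda>k x. \<phi> k x + \<psi> k x) p"
definition "wave_diff p = family_translate (\<lambda>k x. \<phi> k x - \<psi> k x) p"

lemma wave_sum_deriv:
  assumes "x \<in> {-b..b}"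
  shows "((\<lambda>\<sigma>. wave_sum p \<sigma> (c - \<sigma>)) has_vector_derivative \<kappa> x * wave_diff p x (c - x)) (at x within {-b..b})"
proof -
  have "((\<lambda>\<sigma>. wave_sum p \<sigma> (c - 1 * \<sigma>)) has_vector_derivative \<kappa> x * wave_diff p x (c - 1 * x)) (at x within {-b..b})"
    unfolding wave_sum_def wave_diff_def
  proof (rule family_translate_characteristic[where e = 1 and \<kappa> = "\<kappa> x" and x = x
        and \<eta> = "\<lambda>k x. \<phi> k x + \<psi> k x" and \<omega> = "\<lambda>k x. \<phi> k x - \<psi> k x"])
    show "((\<lambda>x. \<phi> k x + \<psi> k x) has_vector_derivative
        \<kappa> x * (\<phi> k x - \<psi> k x) + of_real 1 * of_nat k * (\<phi> (k - 1) x + \<psi> (k - 1) x))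
        (at x within {-b..b})" for k
      using has_vector_derivative_add[OF \<phi>_deriv[OF assms, of k] \<psi>_deriv[OF assms, of k]]
      by (simp add: algebra_simps)
  qed
  then show ?thesis by simp
qed

lemma wave_diff_deriv:
  assumes "x \<in> {-b..b}"
  shows "((\<lambda>\<sigma>. wave_diff p \<sigma> (c + \<sigma>)) has_vector_derivative \<kappa> x * wave_sum p x (c + x)) (at x within {-b..b})"
proof -
  have "((\<lambda>\<sigma>. wave_diff p \<sigma> (c - (-1) * \<sigma>)) has_vector_derivative \<kappa> x * wave_sum p x (c - (-1) * x)) (at x within {-b..b})"
    unfolding wave_sum_def wave_diff_def
  proof (rule family_translate_characteristic[where e = "-1" and \<kappa> = "\<kappa> x" and x = x
        and \<eta> = "\<lambda>k x. \<phi> k x - \<psi> k x" and \<omega> = "\<lambda>k x. \<phi> k x + \<psi> k x"])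
    show "((\<lambda>x. \<phi> k x - \<psi> k x) has_vector_derivative
        \<kappa> x * (\<phi> k x + \<psi> k x) + of_real (-1) * of_nat k * (\<phi> (k - 1) x - \<psi> (k - 1) x))
        (at x within {-b..b})" for k
      using has_vector_derivative_diff[OF \<phi>_deriv[OF assms, of k] \<psi>_deriv[OF assms, of k]]
      by (simp add: algebra_simps)
  qed
  then show ?thesis by simp
qed

lemma
  assumes "\<bar>x\<bar> < b"
  shows wave_sum_deriv_at: "((\<lambda>\<sigma>. wave_sum p \<sigma> (c - \<sigma>)) has_vector_derivative \<kappa> x * wave_diff p x (c - x)) (at x)"
    and wave_diff_deriv_at: "((\<lambda>\<sigma>. wave_diff p \<sigma> (c + \<sigma>)) has_vector_derivative \<kappa> x * wave_sum p x (c + x)) (at x)"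
  using wave_sum_deriv[of x p c] wave_diff_deriv[of x p c] assms
  by (simp_all add: at_within_Icc_at abs_less_iff)

text \<open>The same characteristics run through in the direction of decreasing \<open>x\<close>, parametrised by
  \<open>\<sigma> = d - x\<close>.\<close>

lemma
  assumes "\<bar>x\<bar> < b"
  shows wave_sum_deriv_reflect: "((\<lambda>\<sigma>. wave_sum p (d - \<sigma>) (c + \<sigma>)) has_vector_derivative
      - \<kappa> x * wave_diff p x (c + (d - x))) (at (d - x))"
    and wave_diff_deriv_reflect: "((\<lambda>\<sigma>. wave_diff p (d - \<sigma>) (c - \<sigma>)) has_vector_derivative
      - \<kappa> x * wave_sum p x (c - (d - x))) (at (d - x))"
proof -
  have lin: "((\<lambda>\<sigma>. d - \<sigma>) has_vector_derivative - 1) (at (d - x))"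
    by (auto intro!: derivative_eq_intros)
  have "((\<lambda>\<sigma>. wave_sum p \<sigma> (c + d - \<sigma>)) has_vector_derivative \<kappa> x * wave_diff p x (c + d - x)) (at (d - (d - x)))"
    using wave_sum_deriv_at[OF assms] by simp
  from vector_diff_chain_at[OF lin this]
  show "((\<lambda>\<sigma>. wave_sum p (d - \<sigma>) (c + \<sigma>)) has_vector_derivative
      - \<kappa> x * wave_diff p x (c + (d - x))) (at (d - x))"
    by (simp add: o_def algebra_simps)
  have "((\<lambda>\<sigma>. wave_diff p \<sigma> (c - d + \<sigma>)) has_vector_derivative \<kappa> x * wave_sum p x (c - d + x)) (at (d - (d - x)))"
    using wave_diff_deriv_at[OF assms] by simp
  from vector_diff_chain_at[OF lin this]
  show "((\<lambda>\<sigma>. wave_diff p (d - \<sigma>) (c - \<sigma>)) has_vector_derivative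
      - \<kappa> x * wave_sum p x (c - (d - x))) (at (d - x))"
    by (simp add: o_def algebra_simps)
qed

lemma family_translate_continuous:
  assumes "\<And>k. continuous_on {-b..b} (\<eta> k)" "continuous_on S u" "continuous_on S v"
    "\<And>z. z \<in> S \<Longrightarrow> u z \<in> {-b..b}"
  shows "continuous_on S (\<lambda>z. family_translate \<eta> p (u z) (v z))"
  unfolding family_translate_def taylor_coeff_def
  by (intro continuous_intros assms(3) continuous_on_compose2[OF assms(1,2)])
     (use assms(4) in auto)

lemma wave_continuous:
  assumes "continuous_on S u" "continuous_on S v" "\<And>z. z \<in> S \<Longrightarrow> u z \<in> {-b..b}"
  shows "continuous_on S (\<lambda>z. wave_sum p (u z) (v z))" "continuous_on S (\<lambda>z. wave_diff p (u z) (v z))"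
proof -
  have "continuous_on {-b..b} (\<phi> k)" "continuous_on {-b..b} (\<psi> k)" for k
    by (rule continuous_on_vector_derivative[OF \<phi>_deriv] continuous_on_vector_derivative[OF \<psi>_deriv],
        assumption)+
  then show "continuous_on S (\<lambda>z. wave_sum p (u z) (v z))" "continuous_on S (\<lambda>z. wave_diff p (u z) (v z))"
    unfolding wave_sum_def wave_diff_def using assms
    by (auto intro!: family_translate_continuous continuous_intros)
qed

lemma wave_sum_0: "wave_sum p 0 t = 2 * poly p (of_real t)"
proof -
  have "wave_sum p 0 t = (\<Sum>k\<in>{0}. (\<phi> k 0 + \<psi> k 0) * taylor_coeff p k t)"
    unfolding wave_sum_def family_translate_def
    by (rule sum.mono_neutral_right) (auto simp: \<phi>_0 \<psi>_0)
  then show ?thesis by (simp add: \<phi>_0 \<psi>_0 taylor_coeff_def)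
qed

lemma wave_diff_0: "wave_diff p 0 t = 0"
  by (simp add: wave_diff_def family_translate_def \<phi>_0 \<psi>_0)

lemma poly_map_eq_waves: "poly_map \<phi> p x = (wave_sum p x 0 + wave_diff p x 0) / 2"
  by (simp add: wave_sum_def wave_diff_def poly_map_def family_translate_def taylor_coeff_0
        algebra_simps sum.distrib sum_subtractf)

text \<open>The system is solved from the line \<open>x = 0\<close>, with \<open>x\<close> as the time. For negative \<open>x\<close> the
  reflection \<open>x \<mapsto> -x\<close> exchanges the roles of \<open>A\<close> and \<open>B\<close>.\<close>

lemma poly_map_upper:
  assumes a: "a \<le> b" and N: "\<And>t. t \<in> {-a..a} \<Longrightarrow> cmod (poly p (of_real t)) \<le> N"
    and x: "x \<in> {-a..a}"
  shows "cmod (poly_map \<phi> p x) \<le> 4 * exp (2 * K * b) * N"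
proof -
  have "N \<ge> 0"
    using N[OF x] by (meson norm_ge_zero order_trans)
  have *: "cmod (wave_sum p x 0) \<le> 2 * (2 * N) * exp (2 * K * \<bar>x\<bar>) \<and>
      cmod (wave_diff p x 0) \<le> 2 * (2 * N) * exp (2 * K * \<bar>x\<bar>)"
  proof (cases "x \<ge> 0")
    case True
    have "cmod (wave_sum p x 0) \<le> 2 * (2 * N) * exp (2 * K * x) \<and>
      cmod (wave_diff p x 0) \<le> 2 * (2 * N) * exp (2 * K * x)"
    proof (rule hyperbolic_system_bound[where A = "wave_sum p" and B = "wave_diff p" and a = a and K = K
          and dA = "\<lambda>\<tau> \<xi>. \<kappa> \<tau> * wave_diff p \<tau> \<xi>" and dB = "\<lambda>\<tau> \<xi>. \<kappa> \<tau> * wave_sum p \<tau> \<xi>"])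
      fix \<tau> \<xi> :: real assume *: "0 < \<tau>" "\<tau> < a" "\<bar>\<xi>\<bar> \<le> a - \<tau>"
      show "((\<lambda>\<sigma>. wave_sum p \<sigma> (\<xi> + \<tau> - \<sigma>)) has_vector_derivative \<kappa> \<tau> * wave_diff p \<tau> \<xi>) (at \<tau>)"
        using wave_sum_deriv_at[of \<tau> p "\<xi> + \<tau>"] * a by simp
      show "((\<lambda>\<sigma>. wave_diff p \<sigma> (\<xi> - \<tau> + \<sigma>)) has_vector_derivative \<kappa> \<tau> * wave_sum p \<tau> \<xi>) (at \<tau>)"
        using wave_diff_deriv_at[of \<tau> p "\<xi> - \<tau>"] * a by simp
      show "cmod (\<kappa> \<tau> * wave_diff p \<tau> \<xi>) \<le> K * cmod (wave_diff p \<tau> \<xi>)" "cmod (\<kappa> \<tau> * wave_sum p \<tau> \<xi>) \<le> K * cmod (wave_sum p \<tau> \<xi>)"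
        using * a by (intro norm_\<kappa>_mult; simp)+
    next
      fix \<xi> :: real assume "\<bar>\<xi>\<bar> \<le> a"
      then show "cmod (wave_sum p 0 \<xi>) \<le> 2 * N" "cmod (wave_diff p 0 \<xi>) \<le> 2 * N"
        using N[of \<xi>] \<open>N \<ge> 0\<close> by (simp_all add: wave_sum_0 wave_diff_0 norm_mult abs_le_iff)
    next
      show "continuous_on (triangle a) (\<lambda>z. wave_sum p (fst z) (snd z))"
        "continuous_on (triangle a) (\<lambda>z. wave_diff p (fst z) (snd z))"
        using a by (intro wave_continuous continuous_intros; force simp: triangle_def)+
    qed (use x True K_pos in auto)
    then show ?thesis using True by simp
  next
    case False
    have "cmod (wave_diff p (- (-x)) 0) \<le> 2 * (2 * N) * exp (2 * K * -x) \<and>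
      cmod (wave_sum p (- (-x)) 0) \<le> 2 * (2 * N) * exp (2 * K * -x)"
    proof (rule hyperbolic_system_bound[where A = "\<lambda>\<tau>. wave_diff p (-\<tau>)" and B = "\<lambda>\<tau>. wave_sum p (-\<tau>)" and a = a
          and K = K and dA = "\<lambda>\<tau> \<xi>. - \<kappa> (-\<tau>) * wave_sum p (-\<tau>) \<xi>" and dB = "\<lambda>\<tau> \<xi>. - \<kappa> (-\<tau>) * wave_diff p (-\<tau>) \<xi>"])
      fix \<tau> \<xi> :: real assume *: "0 < \<tau>" "\<tau> < a" "\<bar>\<xi>\<bar> \<le> a - \<tau>"
      show "((\<lambda>\<sigma>. wave_diff p (-\<sigma>) (\<xi> + \<tau> - \<sigma>)) has_vector_derivative - \<kappa> (-\<tau>) * wave_sum p (-\<tau>) \<xi>) (at \<tau>)"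
        using wave_diff_deriv_reflect[of "-\<tau>" p 0 "\<xi> + \<tau>"] * a by simp
      show "((\<lambda>\<sigma>. wave_sum p (-\<sigma>) (\<xi> - \<tau> + \<sigma>)) has_vector_derivative - \<kappa> (-\<tau>) * wave_diff p (-\<tau>) \<xi>) (at \<tau>)"
        using wave_sum_deriv_reflect[of "-\<tau>" p 0 "\<xi> - \<tau>"] * a by simp
      show "cmod (- \<kappa> (-\<tau>) * wave_sum p (-\<tau>) \<xi>) \<le> K * cmod (wave_sum p (-\<tau>) \<xi>)"
        "cmod (- \<kappa> (-\<tau>) * wave_diff p (-\<tau>) \<xi>) \<le> K * cmod (wave_diff p (-\<tau>) \<xi>)"
        using * a norm_\<kappa>_mult[of "-\<tau>"] by simp_all
    next
      fix \<xi> :: real assume "\<bar>\<xi>\<bar> \<le> a"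
      then show "cmod (wave_diff p (-0) \<xi>) \<le> 2 * N" "cmod (wave_sum p (-0) \<xi>) \<le> 2 * N"
        using N[of \<xi>] \<open>N \<ge> 0\<close> by (simp_all add: wave_sum_0 wave_diff_0 norm_mult abs_le_iff)
    next
      show "continuous_on (triangle a) (\<lambda>z. wave_sum p (- fst z) (snd z))"
        "continuous_on (triangle a) (\<lambda>z. wave_diff p (- fst z) (snd z))"
        using a by (intro wave_continuous continuous_intros; force simp: triangle_def)+
    qed (use x False K_pos in auto)
    then show ?thesis using False by simp
  qed
  have "cmod (wave_sum p x 0 + wave_diff p x 0) \<le> 8 * N * exp (2 * K * \<bar>x\<bar>)"
    using * norm_triangle_ineq[of "wave_sum p x 0" "wave_diff p x 0"] by linarith
  also have "\<dots> \<le> 8 * N * exp (2 * K * b)"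
    using x a K_pos \<open>N \<ge> 0\<close> by (intro mult_left_mono) auto
  finally show ?thesis
    by (simp add: poly_map_eq_waves norm_divide mult_ac)
qed

text \<open>Now \<open>t\<close> is the time and the data are given on \<open>t = 0\<close>. Only \<open>W = T p\<close> is under
  control there, not \<open>V\<close>. This is why \<open>p(x + t)\<close> is split into its even and odd part in
  \<open>t\<close>: the image of the even part under the map of \<open>\<phi>\<close>, plus or minus the image of
  the odd part under the map of \<open>\<psi>\<close>, solves a system of the same form, and the odd part vanishes for
  \<open>t = 0\<close>.\<close>

lemma poly_map_lower:
  assumes a: "a \<le> b" and N: "\<And>x. x \<in> {-a..a} \<Longrightarrow> cmod (poly_map \<phi> p x) \<le> N"
    and t: "t \<in> {-a..a}"
  shows "cmod (poly p (of_real t)) \<le> 2 * exp (2 * K * b) * N"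
proof -
  have "N \<ge> 0"
    using N[OF t] by (meson norm_ge_zero order_trans)
  \<comment> \<open>The sum of the two images at time \<open>\<tau>\<close>; their difference is \<open>E (- \<tau>)\<close>.\<close>
  define E where "E \<tau> \<xi> = (wave_sum p \<xi> \<tau> + wave_diff p \<xi> (-\<tau>)) / 2" for \<tau> \<xi>
  have "cmod (E \<bar>t\<bar> 0) \<le> 2 * N * exp (2 * K * \<bar>t\<bar>) \<and> cmod (E (-\<bar>t\<bar>) 0) \<le> 2 * N * exp (2 * K * \<bar>t\<bar>)"
  proof (rule hyperbolic_system_bound[where A = E and B = "\<lambda>\<tau>. E (-\<tau>)" and a = a
        and K = K and dA = "\<lambda>\<tau> \<xi>. - \<kappa> \<xi> * E (-\<tau>) \<xi>" and dB = "\<lambda>\<tau> \<xi>. \<kappa> \<xi> * E \<tau> \<xi>"])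
    fix \<tau> \<xi> :: real assume *: "0 < \<tau>" "\<tau> < a" "\<bar>\<xi>\<bar> \<le> a - \<tau>"
    then have \<xi>: "\<bar>\<xi>\<bar> < b" using a by simp
    have "((\<lambda>\<sigma>. inverse 2 * (wave_sum p (\<xi> + \<tau> - \<sigma>) \<sigma> + wave_diff p (\<xi> + \<tau> - \<sigma>) (-\<sigma>))) has_vector_derivative
       inverse 2 * (- \<kappa> \<xi> * wave_diff p \<xi> \<tau> + - \<kappa> \<xi> * wave_sum p \<xi> (-\<tau>))) (at \<tau>)"
      using wave_sum_deriv_reflect[OF \<xi>, of p "\<xi> + \<tau>" 0] wave_diff_deriv_reflect[OF \<xi>, of p "\<xi> + \<tau>" 0]
      by (intro has_vector_derivative_mult_right has_vector_derivative_add) simp_all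
    then show "((\<lambda>\<sigma>. E \<sigma> (\<xi> + \<tau> - \<sigma>)) has_vector_derivative - \<kappa> \<xi> * E (-\<tau>) \<xi>) (at \<tau>)"
      by (simp add: E_def field_simps)
    have lin: "((\<lambda>\<sigma>. \<xi> - \<tau> + \<sigma>) has_vector_derivative 1) (at \<tau>)"
      by (auto intro!: derivative_eq_intros)
    have "((\<lambda>\<sigma>. wave_sum p \<sigma> (\<xi> - \<tau> - \<sigma>)) has_vector_derivative \<kappa> \<xi> * wave_diff p \<xi> (-\<tau>)) (at (\<xi> - \<tau> + \<tau>))"
      using wave_sum_deriv_at[OF \<xi>, of p "\<xi> - \<tau>"] by simp
    from vector_diff_chain_at[OF lin this]
    have A': "((\<lambda>\<sigma>. wave_sum p (\<xi> - \<tau> + \<sigma>) (-\<sigma>)) has_vector_derivative \<kappa> \<xi> * wave_diff p \<xi> (-\<tau>)) (at \<tau>)"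
      by (simp add: o_def)
    have "((\<lambda>\<sigma>. wave_diff p \<sigma> (\<tau> - \<xi> + \<sigma>)) has_vector_derivative \<kappa> \<xi> * wave_sum p \<xi> \<tau>) (at (\<xi> - \<tau> + \<tau>))"
      using wave_diff_deriv_at[OF \<xi>, of p "\<tau> - \<xi>"] by simp
    from vector_diff_chain_at[OF lin this]
    have B': "((\<lambda>\<sigma>. wave_diff p (\<xi> - \<tau> + \<sigma>) \<sigma>) has_vector_derivative \<kappa> \<xi> * wave_sum p \<xi> \<tau>) (at \<tau>)"
      by (simp add: o_def)
    have "((\<lambda>\<sigma>. inverse 2 * (wave_sum p (\<xi> - \<tau> + \<sigma>) (-\<sigma>) + wave_diff p (\<xi> - \<tau> + \<sigma>) \<sigma>)) has_vector_derivative
       inverse 2 * (\<kappa> \<xi> * wave_diff p \<xi> (-\<tau>) + \<kappa> \<xi> * wave_sum p \<xi> \<tau>)) (at \<tau>)"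
      by (intro has_vector_derivative_mult_right has_vector_derivative_add A' B')
    then show "((\<lambda>\<sigma>. E (-\<sigma>) (\<xi> - \<tau> + \<sigma>)) has_vector_derivative \<kappa> \<xi> * E \<tau> \<xi>) (at \<tau>)"
      by (simp add: E_def field_simps)
    show "cmod (- \<kappa> \<xi> * E (-\<tau>) \<xi>) \<le> K * cmod (E (-\<tau>) \<xi>)" "cmod (\<kappa> \<xi> * E \<tau> \<xi>) \<le> K * cmod (E \<tau> \<xi>)"
      using \<xi> norm_\<kappa>_mult[of \<xi>] by simp_all
  next
    fix \<xi> :: real assume "\<bar>\<xi>\<bar> \<le> a"
    then show "cmod (E 0 \<xi>) \<le> N" "cmod (E (-0) \<xi>) \<le> N"
      using N[of \<xi>] by (simp_all add: E_def poly_map_eq_waves abs_le_iff)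
  next
    have "continuous_on (triangle a) (\<lambda>z. E (u z) (snd z))"
      if "continuous_on (triangle a) u" for u :: "real \<times> real \<Rightarrow> real"
    proof -
      have snd: "snd z \<in> {-b..b}" if "z \<in> triangle a" for z
        using a that by (auto simp: triangle_def)
      show ?thesis
        unfolding E_def
        by (rule continuous_on_divide continuous_on_add wave_continuous continuous_on_snd
            continuous_on_id continuous_on_const continuous_on_minus that snd | assumption | simp)+
    qed
    note E_cont = this
    have "continuous_on (triangle a) fst"
      by (rule continuous_on_fst[OF continuous_on_id])
    then show "continuous_on (triangle a) (\<lambda>z. E (fst z) (snd z))"
      "continuous_on (triangle a) (\<lambda>z. E (- fst z) (snd z))"
      by (intro E_cont continuous_on_minus; assumption)+
  qed (use t K_pos in auto)
  moreover have "poly p (of_real t) = E t 0"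
    by (simp add: E_def wave_sum_0 wave_diff_0)
  ultimately have "cmod (poly p (of_real t)) \<le> 2 * N * exp (2 * K * \<bar>t\<bar>)"
    by (cases "t \<ge> 0") auto
  also have "\<dots> \<le> 2 * N * exp (2 * K * b)"
    using t a K_pos \<open>N \<ge> 0\<close> by (intro mult_left_mono) auto
  finally show ?thesis by (simp add: mult_ac)
qed

end

section \<open>Formal powers of a nonvanishing function\<close>

lemma X_deriv:
  assumes "b > 0" "continuous_on {-b..b} f" "\<forall>x\<in>{-b..b}. f x \<noteq> 0" "x \<in> {-b..b}"
  shows "(X_tilde f (Suc n) has_vector_derivative
      of_nat (Suc n) * (X_tilde f n x * ((f x)\<^sup>2) powi ((-1) ^ n))) (at x within {-b..b})" (is ?T)
    and "(X_plain f (Suc n) has_vector_derivative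
      of_nat (Suc n) * (X_plain f n x * ((f x)\<^sup>2) powi ((-1) ^ Suc n))) (at x within {-b..b})" (is ?P)
proof -
  have step: "((\<lambda>x. of_nat (Suc n) * (LBINT s=0..x. X s * ((f s)\<^sup>2) powi k)) has_vector_derivative
      of_nat (Suc n) * (X x * ((f x)\<^sup>2) powi k)) (at x within {-b..b})"
    if "continuous_on {-b..b} X" "x \<in> {-b..b}" for X :: "real \<Rightarrow> complex" and k n x
  proof -
    have "continuous_on {-b..b} (\<lambda>s. X s * ((f s)\<^sup>2) powi k)"
      using assms that by (intro continuous_intros) auto
    then show ?thesis
      using interval_integral_FTC2[of "-b" 0 b "\<lambda>s. X s * ((f s)\<^sup>2) powi k" x] \<open>b > 0\<close> that
      by (intro has_vector_derivative_mult_right) (simp add: zero_ereal_def)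
  qed
  have cont: "continuous_on {-b..b} (X_tilde f n) \<and> continuous_on {-b..b} (X_plain f n)" for n
  proof (induction n)
    case (Suc n)
    then show ?case
      using continuous_on_vector_derivative[OF step, of "X_tilde f n"]
        continuous_on_vector_derivative[OF step, of "X_plain f n"]
      by auto
  qed auto
  show ?T ?P
    using step[of "X_tilde f n" x n] step[of "X_plain f n" x n] cont[of n] assms by simp_all
qed

text \<open>Replacing \<open>f\<close> by its inverse changes the sign of all exponents and so exchanges the two families.\<close>

lemma X_inverse:
  "X_tilde (\<lambda>x. inverse (f x)) n = X_plain f n" "X_plain (\<lambda>x. inverse (f x)) n = X_tilde f n"
proof (induction n)
  case (Suc n)
  have *: "((inverse z)\<^sup>2) powi k = (z\<^sup>2) powi (- k)" for z :: complex and k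
    by (simp add: power_inverse power_int_inverse power_int_minus)
  case 1
  show ?case using Suc by (simp add: *)
  case 2
  show ?case using Suc by (simp add: *)
qed auto

lemma phi_inverse:
  "phi (\<lambda>x. inverse (f x)) k x = inverse (f x) * (if odd k then X_tilde f k x else X_plain f k x)"
  by (simp add: phi_def X_inverse)

lemma X_0: "X_tilde f n 0 = (if n = 0 then 1 else 0)" "X_plain f n 0 = (if n = 0 then 1 else 0)"
  by (cases n; simp add: zero_ereal_def)+

lemma phi_deriv:
  assumes b: "b > 0" and cont: "continuous_on {-b..b} f" and nz: "\<forall>x\<in>{-b..b}. f x \<noteq> 0"
    and f': "(f has_vector_derivative f') (at x within {-b..b})" and x: "x \<in> {-b..b}"
  shows "(phi f k has_vector_derivative
      f' / f x * phi f k x + of_nat k * phi (\<lambda>x. inverse (f x)) (k - 1) x) (at x within {-b..b})"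
proof (cases k)
  case 0
  then show ?thesis
    using f' nz x by (simp add: phi_def)
next
  case (Suc n)
  have fx: "f x \<noteq> 0" using nz x by auto
  show ?thesis
  proof (cases "odd k")
    case True
    have phi_eq: "phi f k = (\<lambda>x. f x * X_plain f (Suc n) x)"
      using True by (simp add: phi_def Suc)
    have [simp]: "(-1::int) ^ n = 1" using True Suc by simp
    show ?thesis
      unfolding phi_eq phi_inverse
      using True fx
      by (intro has_vector_derivative_eq_rhs[OF has_vector_derivative_mult[OF f' X_deriv(2)[OF b cont nz x, of n]]])
         (simp add: Suc power_int_minus field_simps power2_eq_square
          del: X_plain.simps X_tilde.simps)
  next
    case False
    have phi_eq: "phi f k = (\<lambda>x. f x * X_tilde f (Suc n) x)"
      using False by (simp add: phi_def Suc)
    have [simp]: "(-1::int) ^ n = -1" using False Suc by simp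
    show ?thesis
      unfolding phi_eq phi_inverse
      using False fx
      by (intro has_vector_derivative_eq_rhs[OF has_vector_derivative_mult[OF f' X_deriv(1)[OF b cont nz x, of n]]])
         (simp add: Suc power_int_minus field_simps power2_eq_square
          del: X_plain.simps X_tilde.simps)
  qed
qed

lemma inverse_has_vector_derivative:
  fixes f :: "real \<Rightarrow> complex"
  assumes f': "(f has_vector_derivative f') (at x within S)" and nz: "f x \<noteq> 0"
  shows "((\<lambda>x. inverse (f x)) has_vector_derivative - (f' / f x) * inverse (f x)) (at x within S)"
proof -
  have "(inverse has_field_derivative - (inverse (f x) * inverse (f x))) (at (f x) within f ` S)"
    using nz DERIV_inverse'[OF DERIV_ident, of "f x"] by auto
  from field_vector_diff_chain_within[OF f' this] show ?thesis
    by (simp add: o_def field_simps)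
qed

text \<open>The constant \<open>K\<close> is a bound for \<open>f'/f\<close> on the compact interval. The family of \<open>1/f\<close>
  has the logarithmic derivative \<open>-f'/f\<close>, as the locale requires.\<close>

lemma phi_transmutation:
  assumes b: "b > 0" and nz: "\<forall>x\<in>{-b..b}. f x \<noteq> 0" and f0: "f 0 = 1"
    and f': "\<And>x. x \<in> {-b..b} \<Longrightarrow> (f has_vector_derivative f' x) (at x within {-b..b})"
    and cont': "continuous_on {-b..b} f'"
  obtains K where "transmutation (phi f) (phi (\<lambda>x. inverse (f x))) (\<lambda>x. f' x / f x) b K"
proof -
  have cont: "continuous_on {-b..b} f"
    using f' by (rule continuous_on_vector_derivative)
  have "continuous_on {-b..b} (\<lambda>x. f' x / f x)"
    using cont cont' nz by (intro continuous_intros) auto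
  then have "bounded ((\<lambda>x. f' x / f x) ` {-b..b})"
    by (intro compact_imp_bounded compact_continuous_image) auto
  then obtain K where K: "K > 0" "\<And>x. x \<in> {-b..b} \<Longrightarrow> cmod (f' x / f x) \<le> K"
    unfolding bounded_pos by auto
  have inv': "((\<lambda>x. inverse (f x)) has_vector_derivative - (f' x / f x) * inverse (f x)) (at x within {-b..b})"
    if "x \<in> {-b..b}" for x
    using inverse_has_vector_derivative[OF f'[OF that]] nz that by auto
  have inv_cont: "continuous_on {-b..b} (\<lambda>x. inverse (f x))"
    using inv' by (rule continuous_on_vector_derivative)
  have "transmutation (phi f) (phi (\<lambda>x. inverse (f x))) (\<lambda>x. f' x / f x) b K"
  proof
    fix k x assume x: "x \<in> {-b..b}"
    then have fx: "f x \<noteq> 0" using nz by auto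
    show "(phi f k has_vector_derivative f' x / f x * phi f k x +
        of_nat k * phi (\<lambda>x. inverse (f x)) (k - 1) x) (at x within {-b..b})"
      by (rule phi_deriv[OF b cont nz f'[OF x] x])
    show "(phi (\<lambda>x. inverse (f x)) k has_vector_derivative
        - (f' x / f x) * phi (\<lambda>x. inverse (f x)) k x + of_nat k * phi f (k - 1) x) (at x within {-b..b})"
      using phi_deriv[OF b inv_cont _ inv'[OF x] x, of k] nz fx
      by (simp add: field_simps power2_eq_square)
  next
    show "phi f k 0 = (if k = 0 then 1 else 0)"
      "phi (\<lambda>x. inverse (f x)) k 0 = (if k = 0 then 1 else 0)" for k
      by (simp_all add: phi_def phi_inverse X_0 f0)
  qed (use b K in auto)
  then show ?thesis by (rule that)
qed

lemma Phi_eq_poly_map: "h \<in> Phi f n \<longleftrightarrow> (\<exists>p. degree p \<le> n \<and> h = poly_map (phi f) p)"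
proof
  assume "h \<in> Phi f n"
  then obtain c where h: "h = (\<lambda>x. \<Sum>k\<le>n. c k * phi f k x)"
    by (auto simp: Phi_def)
  define p where "p = (\<Sum>k\<le>n. monom (c k) k)"
  have deg: "degree p \<le> n"
    unfolding p_def by (intro degree_sum_le) (auto intro: order_trans[OF degree_monom_le])
  have "coeff p k = c k" if "k \<le> n" for k
    using that by (simp add: p_def coeff_sum)
  then have "h = poly_map (phi f) p"
    by (simp add: h fun_eq_iff poly_map_eq_sum[OF deg])
  with deg show "\<exists>p. degree p \<le> n \<and> h = poly_map (phi f) p" by blast
next
  assume "\<exists>p. degree p \<le> n \<and> h = poly_map (phi f) p"
  then show "h \<in> Phi f n"
    by (auto simp: Phi_def fun_eq_iff poly_map_eq_sum)
qed

text \<open>A strict inequality is what makes an approximant available without knowing that the infimum is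
  attained.\<close>

lemma near_best_approx:
  assumes b: "b > 0" and g: "continuous_on {-b..b} g"
    and \<phi>: "\<And>k. continuous_on {-b..b} (phi f k)"
    and le: "best_approx b f n g < E"
  obtains p where "degree p \<le> n" "\<And>x. x \<in> {-b..b} \<Longrightarrow> cmod (g x - poly_map (phi f) p x) \<le> E"
proof -
  have "Phi f n \<noteq> {}" by (auto simp: Phi_def)
  then obtain h where h: "h \<in> Phi f n" "unif_norm b (\<lambda>x. g x - h x) < E"
    using le cInf_lessD[of "(\<lambda>h. unif_norm b (\<lambda>x. g x - h x)) ` Phi f n" E]
    unfolding best_approx_def by auto
  then obtain p where p: "degree p \<le> n" "h = poly_map (phi f) p"
    by (auto simp: Phi_eq_poly_map)
  have "continuous_on {-b..b} (\<lambda>x. cmod (g x - h x))"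
    unfolding p(2) poly_map_def by (intro continuous_intros g \<phi>)
  then have "bdd_above ((\<lambda>x. cmod (g x - h x)) ` {-b..b})"
    by (intro bounded_imp_bdd_above compact_imp_bounded compact_continuous_image) auto
  then have "cmod (g x - h x) \<le> unif_norm b (\<lambda>x. g x - h x)" if "x \<in> {-b..b}" for x
    unfolding unif_norm_def using that by (rule cSUP_upper[rotated])
  then show ?thesis
    using h(2) p by (intro that[of p]) force+
qed

section \<open>Uniform limits of the derivatives\<close>

text \<open>The function \<open>lim\<close> does not refer to the set of uniform convergence, so that limits obtained on
  different intervals are restrictions of one function.\<close>

lemma geometric_increments_uniform_limit:
  fixes v :: "nat \<Rightarrow> real \<Rightarrow> complex"
  assumes \<rho>: "0 \<le> \<rho>" "\<rho> < 1"
    and incr: "\<And>j x. x \<in> I \<Longrightarrow> cmod (v (Suc j) x - v j x) \<le> C * \<rho> ^ j"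
  shows "uniform_limit I v (\<lambda>x. lim (\<lambda>j. v j x)) sequentially"
proof -
  define L where "L = (\<lambda>x. \<Sum>i. v (Suc i) x - v i x)"
  have "uniform_limit I (\<lambda>n x. \<Sum>i<n. v (Suc i) x - v i x) L sequentially"
    unfolding L_def
    by (rule Weierstrass_m_test[OF incr]) (use \<rho> in \<open>auto intro!: summable_mult summable_geometric\<close>)
  then have "uniform_limit I (\<lambda>n x. v n x - v 0 x) L sequentially"
    by (subst (asm) sum_lessThan_telescope)
  then have "uniform_limit I (\<lambda>n x. (v n x - v 0 x) + v 0 x) (\<lambda>x. L x + v 0 x) sequentially"
    by (intro uniform_limit_add uniform_limit_const)
  then have lim: "uniform_limit I v (\<lambda>x. L x + v 0 x) sequentially"
    by simp
  have "lim (\<lambda>j. v j x) = L x + v 0 x" if "x \<in> I" for x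
    by (rule limI) (rule tendsto_uniform_limitI[OF lim that])
  then show ?thesis
    by (intro uniform_limit_cong'[THEN iffD2, OF _ _ lim]) auto
qed

lemma has_vector_derivative_of_uniform_limit:
  fixes v v' :: "nat \<Rightarrow> real \<Rightarrow> complex"
  assumes I: "convex I"
    and deriv: "\<And>j x. x \<in> I \<Longrightarrow> (v j has_vector_derivative v' j x) (at x within I)"
    and lim: "\<And>x. x \<in> I \<Longrightarrow> (\<lambda>j. v j x) \<longlonglongrightarrow> V x"
    and lim': "uniform_limit I v' V' sequentially"
    and x: "x \<in> I"
  shows "(V has_vector_derivative V' x) (at x within I)"
proof -
  have "\<exists>g. \<forall>x\<in>I. (\<lambda>n. v n x) \<longlonglongrightarrow> g x \<and> (g has_derivative (\<lambda>h. h *\<^sub>R V' x)) (at x within I)"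
  proof (rule has_derivative_sequence[OF I, where f' = "\<lambda>j x h. h *\<^sub>R v' j x"])
    show "(v j has_derivative (\<lambda>h. h *\<^sub>R v' j x)) (at x within I)" if "x \<in> I" for j x
      using deriv[OF that] by (simp add: has_vector_derivative_def)
    show "\<forall>\<^sub>F n in sequentially. \<forall>x\<in>I. \<forall>h. norm (h *\<^sub>R v' n x - h *\<^sub>R V' x) \<le> e * norm h"
      if "e > 0" for e
      using uniform_limitD[OF lim' that]
    proof eventually_elim
      case (elim n)
      show ?case
      proof (intro ballI allI)
        fix x h assume "x \<in> I"
        then have "norm (v' n x - V' x) \<le> e"
          using elim by (force simp: dist_norm)
        then show "norm (h *\<^sub>R v' n x - h *\<^sub>R V' x) \<le> e * norm h"
          by (simp add: mult_mono mult.commute[of e] flip: scaleR_diff_right)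
      qed
    qed
  qed (use x lim in auto)
  then obtain g where g: "\<And>x. x \<in> I \<Longrightarrow> (\<lambda>n. v n x) \<longlonglongrightarrow> g x"
    "\<And>x. x \<in> I \<Longrightarrow> (g has_vector_derivative V' x) (at x within I)"
    by (auto simp: has_vector_derivative_def)
  have "V y = g y" if "y \<in> I" for y
    using LIMSEQ_unique[OF lim[OF that] g(1)[OF that]] .
  then show ?thesis
    using g(2)[OF x] x by (intro has_vector_derivative_transform[where f = g and g = V]) auto
qed

text \<open>Candidates \<open>G\<^sub>k\<close> that satisfy the recursion of the \<open>f\<close>-derivatives on a relatively open
  set are the \<open>f\<close>-derivatives there. Openness is needed because \<open>f_deriv\<close> is known to agree
  with \<open>G\<^sub>k\<close> on the set only, while its derivative at \<open>x\<close> looks at all nearby points.\<close>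

lemma f_deriv_eqI:
  assumes b: "b > 0" and nz: "\<forall>x\<in>{-b..b}. f x \<noteq> 0" and S: "S \<subseteq> {-b..b}"
    and S_open: "\<And>x. x \<in> S \<Longrightarrow> \<forall>\<^sub>F y in at x within {-b..b}. y \<in> S"
    and G0: "\<And>x. x \<in> S \<Longrightarrow> G 0 x = g x"
    and G_Suc: "\<And>k x. k < m \<Longrightarrow> x \<in> S \<Longrightarrow> ((\<lambda>s. f s powi ((-1) ^ Suc k) * G k s)
      has_vector_derivative f x powi ((-1) ^ Suc k) * G (Suc k) x) (at x within {-b..b})"
    and "k \<le> m"
  shows "\<forall>x\<in>S. has_f_deriv b f g k x \<and> f_deriv b f g k x = G k x"
  using \<open>k \<le> m\<close>
proof (induction k)
  case 0
  then show ?case using G0 by simp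
next
  case (Suc k)
  then have IH: "\<And>y. y \<in> S \<Longrightarrow> has_f_deriv b f g k y" "\<And>y. y \<in> S \<Longrightarrow> f_deriv b f g k y = G k y"
    by auto
  show ?case
  proof
    fix x assume x: "x \<in> S"
    define e :: int where "e = (-1) ^ k"
    have e: "(-1) ^ Suc k = - e" by (simp add: e_def)
    have "((\<lambda>s. f s powi - e * G k s) has_vector_derivative f x powi - e * G (Suc k) x)
        (at x within {-b..b})"
      using G_Suc[of k x] Suc.prems x e by simp
    moreover have "\<forall>\<^sub>F y in at x within {-b..b}. f y powi - e * G k y = f y powi - e * f_deriv b f g k y"
      using S_open[OF x] by eventually_elim (simp add: IH)
    ultimately have D: "((\<lambda>s. f s powi - e * f_deriv b f g k s) has_vector_derivative
        f x powi - e * G (Suc k) x) (at x within {-b..b})"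
      unfolding has_vector_derivative_def
      by (rule has_derivative_transform_eventually) (use x S IH in auto)
    have "vector_derivative (\<lambda>s. f s powi - e * f_deriv b f g k s) (at x within {-b..b})
        = f x powi - e * G (Suc k) x"
      by (rule vector_derivative_within_closed_interval) (use b x S D in auto)
    moreover have "f x \<noteq> 0"
      using nz x S by auto
    ultimately have "f_deriv b f g (Suc k) x = G (Suc k) x"
      by (simp add: e flip: e_def) (simp add: power_int_minus)
    moreover have "\<forall>\<^sub>F y in at x within {-b..b}. has_f_deriv b f g k y"
      using S_open[OF x] by eventually_elim (rule IH)
    moreover have "(\<lambda>s. f s powi - e * f_deriv b f g k s) differentiable (at x within {-b..b})"
      using D by (rule differentiableI_vector)
    ultimately show "has_f_deriv b f g (Suc k) x \<and> f_deriv b f g (Suc k) x = G (Suc k) x"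
      unfolding has_f_deriv.simps e using IH(1)[OF x] by blast
  qed
qed

lemma higher_pderiv_diff: "(pderiv ^^ k) (p - q) = (pderiv ^^ k) p - (pderiv ^^ k) (q :: complex poly)"
  by (induction k) (simp_all add: pderiv_diff)

text \<open>The lower estimate passes from \<open>T d\<^sub>j\<close> to \<open>d\<^sub>j\<close> on \<open>[-b, b]\<close>,
  differentiation costs a factor \<open>(2\<^bsup>j+1\<^esup>)\<^sup>s\<close> with \<open>s \<le> r\<close>, and the
  upper estimate on \<open>[-a, a]\<close> passes to the image of the derivative. The decay
  \<open>2\<^bsup>-j\<epsilon>\<^esup>\<close> is what is left over.\<close>

lemma dyadic_increment_bound:
  assumes tr0: "transmutation \<phi>0 \<psi>0 \<kappa>0 b K" and tr: "transmutation \<phi> \<psi> \<kappa> b K"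
    and a: "a \<le> b" and growth: "derivative_growth a b k s" and s: "s \<le> r"
    and deg: "\<And>j. degree (d j) \<le> 2 ^ Suc j"
    and small: "\<And>j x. x \<in> {-b..b} \<Longrightarrow> cmod (poly_map \<phi>0 (d j) x) \<le> M * (2 powr - (real r + \<epsilon>)) ^ j"
  shows "\<exists>C. \<forall>j. \<forall>x\<in>{-a..a}.
    cmod (poly_map \<phi> ((pderiv ^^ k) (d j)) x) \<le> C * (2 powr - \<epsilon>) ^ j"
proof -
  obtain C where C: "C \<ge> 0" "\<And>n p N t. n \<ge> 1 \<Longrightarrow> degree p \<le> n \<Longrightarrow>
      (\<And>t. t\<in>{-b..b} \<Longrightarrow> cmod (poly p (of_real t)) \<le> N) \<Longrightarrow> t \<in> {-a..a} \<Longrightarrow>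
      cmod (poly ((pderiv ^^ k) p) (of_real t)) \<le> C * real n ^ s * N"
    using growth unfolding derivative_growth_def by blast
  define E where "E = exp (2 * K * b)"
  have E: "E > 0" by (simp add: E_def)
  have "b > 0" using tr by (simp add: transmutation_def)
  have "M \<ge> 0"
    using small[of 0 0] \<open>b > 0\<close> by simp (meson norm_ge_zero order_trans)
  have "cmod (poly_map \<phi> ((pderiv ^^ k) (d j)) x) \<le> 4 * E * (C * 2 ^ r * (2 * E * M)) * (2 powr - \<epsilon>) ^ j"
    if x: "x \<in> {-a..a}" for j x
  proof -
    define N where "N = M * (2 powr - (real r + \<epsilon>)) ^ j"
    have N: "N \<ge> 0" using \<open>M \<ge> 0\<close> by (simp add: N_def)
    have lower: "cmod (poly (d j) (of_real t)) \<le> 2 * E * N" if "t \<in> {-b..b}" for t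
      unfolding E_def N_def
      by (rule transmutation.poly_map_lower[OF tr0 order_refl small that])
    have "cmod (poly ((pderiv ^^ k) (d j)) (of_real t)) \<le> C * real (2 ^ Suc j) ^ s * (2 * E * N)"
      if "t \<in> {-a..a}" for t
      by (rule C(2)[OF _ deg lower that]) auto
    then have "cmod (poly_map \<phi> ((pderiv ^^ k) (d j)) x) \<le> 4 * E * (C * real (2 ^ Suc j) ^ s * (2 * E * N))"
      unfolding E_def by (rule transmutation.poly_map_upper[OF tr a _ x])
    also have "\<dots> \<le> 4 * E * (C * (2 ^ Suc j) ^ r * (2 * E * N))"
    proof -
      have "real (2 ^ Suc j) ^ s \<le> (2 ^ Suc j) ^ r"
        unfolding of_nat_power of_nat_numeral using s by (intro power_increasing one_le_power) auto
      then show ?thesis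
        using E N C(1) by (intro mult_left_mono mult_right_mono) auto
    qed
    also have "(2 ^ Suc j) ^ r * (2 powr - (real r + \<epsilon>)) ^ j = 2 ^ r * (2 powr - \<epsilon>) ^ j"
    proof -
      have "(2 powr - (real r + \<epsilon>) :: real) = 2 powr - \<epsilon> / 2 ^ r"
        unfolding minus_add_distrib add.commute[of "- real r"] powr_add
        by (simp add: powr_minus powr_realpow divide_inverse)
      then have "2 powr - \<epsilon> = 2 ^ r * 2 powr - (real r + \<epsilon>)"
        by simp
      moreover have "(2 ^ Suc j :: real) ^ r = 2 ^ r * (2 ^ r) ^ j"
        by (simp add: power_mult_distrib mult.commute flip: power_mult)
      ultimately show ?thesis
        by (simp only: power_mult_distrib mult.assoc)
    qed
    then have "4 * E * (C * (2 ^ Suc j) ^ r * (2 * E * N)) = 4 * E * (C * 2 ^ r * (2 * E * M)) * (2 powr - \<epsilon>) ^ j"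
      by (simp add: N_def)
    finally show ?thesis .
  qed
  then show ?thesis by blast
qed

theorem theorem31:
  fixes b M \<epsilon> :: real and q f g :: "real \<Rightarrow> complex" and r :: nat
  assumes "b > 0"
    and "continuous_on {-b..b} q"
    and "C2_solution b q f"
    and "\<forall>x\<in>{-b..b}. f x \<noteq> 0"
    and "f 0 = 1"
    and "continuous_on {-b..b} g"
    and "M > 0" and "\<epsilon> > 0"
    and "\<forall>n::nat. n \<ge> 1 \<longrightarrow> best_approx b f n g \<le> M / real n powr (real r + \<epsilon>)"
  shows "(\<forall>x\<in>{-b<..<b}. has_f_deriv b f g r x) \<and>
         (\<forall>x\<in>{-b, b}. has_f_deriv b f g (r div 2) x)"
proof -
  note b = \<open>b > 0\<close> and nz = \<open>\<forall>x\<in>{-b..b}. f x \<noteq> 0\<close>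
  define fi where "fi = (\<lambda>x. inverse (f x))"
  obtain f' where f': "\<And>x. x \<in> {-b..b} \<Longrightarrow> (f has_vector_derivative f' x) (at x within {-b..b})"
    and f'_cont: "continuous_on {-b..b} f'"
    using assms(3) unfolding C2_solution_def by (blast intro: continuous_on_vector_derivative)
  obtain K where tr: "transmutation (phi f) (phi fi) (\<lambda>x. f' x / f x) b K"
    unfolding fi_def using phi_transmutation[OF b nz \<open>f 0 = 1\<close> f' f'_cont] .
  have tr': "transmutation (phi fi) (phi f) (\<lambda>x. - (f' x / f x)) b K"
    using transmutation.swap[OF tr] .
  have phi_cont: "continuous_on {-b..b} (phi f k)" for k
    using transmutation.\<phi>_deriv[OF tr] by (rule continuous_on_vector_derivative)
  have f_cont: "continuous_on {-b..b} f"
    using f' by (rule continuous_on_vector_derivative)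

  \<comment> \<open>The family in which the \<open>f\<close>-derivative of order \<open>k\<close> is expanded, and the factor by which it is multiplied before the next differentiation.\<close>
  define fam where "fam k = phi (if even k then f else fi)" for k :: nat
  define u where "u k x = f x powi ((-1) ^ Suc k)" for k :: nat and x
  have fam_tr: "\<exists>\<psi> \<kappa>. transmutation (fam k) \<psi> \<kappa> b K" for k
    using tr tr' by (cases "even k") (auto simp: fam_def)

  define \<delta> where "\<delta> = 2 powr - (real r + \<epsilon>)"
  define \<rho> where "\<rho> = 2 powr - \<epsilon>"
  have \<delta>: "0 < \<delta>" "\<delta> < 1" and \<rho>: "0 \<le> \<rho>" "\<rho> < 1"
    using \<open>\<epsilon> > 0\<close> by (auto simp: \<delta>_def \<rho>_def powr_less_one)

  have "\<exists>p. degree p \<le> 2 ^ j \<and> (\<forall>x\<in>{-b..b}. cmod (g x - poly_map (phi f) p x) \<le> 2 * M * \<delta> ^ j)" for j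
  proof -
    have "best_approx b f (2 ^ j) g \<le> M / real (2 ^ j) powr (real r + \<epsilon>)"
      using assms(9)[rule_format, of "2 ^ j"] by simp
    also have "real (2 ^ j) powr (real r + \<epsilon>) = inverse (\<delta> ^ j)"
    proof -
      have "real (2 ^ j) powr (real r + \<epsilon>) = (2 powr (real r + \<epsilon>)) ^ j"
        using powr_powr_swap[of 2 "real j" "real r + \<epsilon>"] by (simp add: powr_realpow)
      moreover have "\<delta> = inverse (2 powr (real r + \<epsilon>))"
        unfolding \<delta>_def by (rule powr_minus)
      ultimately show ?thesis by (simp only: power_inverse inverse_inverse_eq)
    qed
    \<comment> \<open>The factor \<open>2\<close> makes the inequality strict, as \<open>near_best_approx\<close> requires.\<close>
    also have "M / inverse (\<delta> ^ j) < 2 * M * \<delta> ^ j"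
      using \<open>M > 0\<close> \<delta> by (simp add: field_simps)
    finally show ?thesis
      by (rule near_best_approx[OF b \<open>continuous_on {-b..b} g\<close> phi_cont]) blast
  qed
  then obtain p where deg: "\<And>j. degree (p j) \<le> 2 ^ j"
    and p: "\<And>j x. x \<in> {-b..b} \<Longrightarrow> cmod (g x - poly_map (phi f) (p j) x) \<le> 2 * M * \<delta> ^ j"
    by metis

  \<comment> \<open>The \<open>f\<close>-derivative of order \<open>k\<close> of the \<open>j\<close>-th approximant, and the limit that will be the one of \<open>g\<close>.\<close>
  define D where "D k j = poly_map (fam k) ((pderiv ^^ k) (p j))" for k j
  define G where "G k x = lim (\<lambda>j. D k j x)" for k x

  have D_deriv: "((\<lambda>s. u k s * D k j s) has_vector_derivative u k x * D (Suc k) j x) (at x within {-b..b})"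
    if x: "x \<in> {-b..b}" for k j x
  proof (cases "even k")
    case True
    have "((\<lambda>x. inverse (f x)) has_vector_derivative - (f' x / f x) * inverse (f x)) (at x within {-b..b})"
      using inverse_has_vector_derivative[OF f'[OF x]] nz x by auto
    from transmutation.integrating_factor_deriv[OF tr x this] show ?thesis
      using True by (simp add: u_def D_def fam_def power_int_minus)
  next
    case False
    have "(f has_vector_derivative - (- (f' x / f x)) * f x) (at x within {-b..b})"
      using f'[OF x] nz x by simp
    from transmutation.integrating_factor_deriv[OF tr' x this] show ?thesis
      using False by (simp add: u_def D_def fam_def)
  qed

  have increment: "cmod (poly_map (phi f) (p (Suc j) - p j) x) \<le> 4 * M * \<delta> ^ j" if "x \<in> {-b..b}" for j x
  proof -
    have "cmod (poly_map (phi f) (p (Suc j)) x - poly_map (phi f) (p j) x) \<le>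
        cmod (g x - poly_map (phi f) (p j) x) + cmod (g x - poly_map (phi f) (p (Suc j)) x)"
      using norm_triangle_ineq4[of "g x - poly_map (phi f) (p j) x" "g x - poly_map (phi f) (p (Suc j)) x"]
      by simp
    also have "\<dots> \<le> 2 * M * \<delta> ^ j + 2 * M * \<delta> ^ Suc j"
      using p[OF that] by (intro add_mono)
    also have "\<dots> \<le> 4 * M * \<delta> ^ j"
      using \<delta> \<open>M > 0\<close> by (simp add: mult_left_le_one_le)
    finally show ?thesis by (simp add: poly_map_diff)
  qed

  have D_lim: "uniform_limit {-a..a} (D k) (G k) sequentially"
    if ab: "a \<le> b" and growth: "derivative_growth a b k s" and s: "s \<le> r" for a k s
  proof -
    obtain \<psi> \<kappa> where tr_k: "transmutation (fam k) \<psi> \<kappa> b K"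
      using fam_tr by blast
    have deg_diff: "degree (p (Suc j) - p j) \<le> 2 ^ Suc j" for j
      using deg[of j] deg[of "Suc j"] by (intro degree_diff_le) auto
    obtain C where C: "\<And>j x. x \<in> {-a..a} \<Longrightarrow>
        cmod (poly_map (fam k) ((pderiv ^^ k) (p (Suc j) - p j)) x) \<le> C * \<rho> ^ j"
      unfolding \<rho>_def
      using dyadic_increment_bound[OF tr tr_k ab growth s deg_diff increment[unfolded \<delta>_def]] by blast
    show ?thesis
      unfolding G_def
      by (rule geometric_increments_uniform_limit[OF \<rho>])
         (use C in \<open>simp add: D_def higher_pderiv_diff poly_map_diff\<close>)
  qed

  have G_deriv: "((\<lambda>s. u k s * G k s) has_vector_derivative u k x * G (Suc k) x) (at x within {-b..b})"
    if a: "a \<le> b" and x: "x \<in> {-a..a}" and at: "at x within {-a..a} = at x within {-b..b}"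
      and growth: "derivative_growth a b k s" "derivative_growth a b (Suc k) t" and st: "s \<le> r" "t \<le> r"
    for a k x s t
  proof -
    have sub: "{-a..a} \<subseteq> {-b..b}" using a by auto
    note lim = D_lim[OF a growth(1) st(1)] and lim' = D_lim[OF a growth(2) st(2)]
    have u_cont: "continuous_on {-a..a} (u k)"
      unfolding u_def using sub nz by (intro continuous_intros continuous_on_subset[OF f_cont]) auto
    have "uniform_limit {-a..a} (\<lambda>j x. u k x * D (Suc k) j x) (\<lambda>x. u k x * G (Suc k) x) sequentially"
    proof (rule uniform_lim_mult[OF uniform_limit_const lim'])
      show "bounded (u k ` {-a..a})"
        using u_cont by (intro compact_imp_bounded compact_continuous_image) auto
      have "continuous_on {-a..a} (D (Suc k) j)" for j
      proof -
        obtain \<psi> \<kappa> where "transmutation (fam (Suc k)) \<psi> \<kappa> b K"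
          using fam_tr by blast
        from transmutation.poly_map_deriv[OF this] have "continuous_on {-b..b} (D (Suc k) j)"
          unfolding D_def by (rule continuous_on_vector_derivative)
        then show ?thesis using sub by (rule continuous_on_subset)
      qed
      then have "continuous_on {-a..a} (G (Suc k))"
        by (intro uniform_limit_theorem[OF _ lim']) auto
      then show "bounded (G (Suc k) ` {-a..a})"
        by (intro compact_imp_bounded compact_continuous_image) auto
    qed
    then have "((\<lambda>s. u k s * G k s) has_vector_derivative u k x * G (Suc k) x) (at x within {-a..a})"
    proof (rule has_vector_derivative_of_uniform_limit[rotated 3])
      show "((\<lambda>s. u k s * D k j s) has_vector_derivative u k x * D (Suc k) j x) (at x within {-a..a})"
        if "x \<in> {-a..a}" for j x
        using D_deriv sub that by (blast intro: has_vector_derivative_within_subset)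
      show "(\<lambda>j. u k x * D k j x) \<longlonglongrightarrow> u k x * G k x" if "x \<in> {-a..a}" for x
        using tendsto_uniform_limitI[OF lim that] by (intro tendsto_intros)
    qed (use x in auto)
    then show ?thesis by (simp only: at)
  qed

  have G_0: "G 0 x = g x" if x: "x \<in> {-b..b}" for x
  proof -
    have "(\<lambda>j. g x - D 0 j x) \<longlonglongrightarrow> 0"
    proof (rule Lim_null_comparison)
      show "\<forall>\<^sub>F j in sequentially. norm (g x - D 0 j x) \<le> 2 * M * \<delta> ^ j"
        using p[OF x] by (simp add: D_def fam_def)
      show "(\<lambda>j. 2 * M * \<delta> ^ j) \<longlonglongrightarrow> 0"
        using \<delta> by (intro tendsto_mult_right_zero LIMSEQ_realpow_zero) auto
    qed
    then have "(\<lambda>j. g x - (g x - D 0 j x)) \<longlonglongrightarrow> g x - 0"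
      by (intro tendsto_intros)
    then show ?thesis
      unfolding G_def by (intro limI) simp
  qed

  have interior: "has_f_deriv b f g r x" if "x \<in> {-b<..<b}" for x
  proof -
    have "\<forall>x\<in>{-b<..<b}. has_f_deriv b f g r x \<and> f_deriv b f g r x = G r x"
    proof (rule f_deriv_eqI[OF b nz])
      fix k x assume k: "k < r" and x: "x \<in> {-b<..<b}"
      define a where "a = (\<bar>x\<bar> + b) / 2"
      have a: "\<bar>x\<bar> < a" "a < b" using x by (auto simp: a_def)
      have "at x within {-a..a} = at x within {-b..b}"
        using a x by (simp add: at_within_Icc_at abs_less_iff)
      then have "((\<lambda>s. u k s * G k s) has_vector_derivative u k x * G (Suc k) x) (at x within {-b..b})"
        by (rule G_deriv[rotated 2])
           (use a k derivative_growth_interior[OF a(2) b] in auto)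
      then show "((\<lambda>s. f s powi ((-1) ^ Suc k) * G k s) has_vector_derivative
          f x powi ((-1) ^ Suc k) * G (Suc k) x) (at x within {-b..b})"
        by (simp only: u_def)
    next
      fix x assume "x \<in> {-b<..<b}"
      then show "\<forall>\<^sub>F y in at x within {-b..b}. y \<in> {-b<..<b}"
        by (auto simp: eventually_at_filter
            intro: eventually_mono[OF eventually_nhds_in_open[of "{-b<..<b}" x]])
    qed (use G_0 in auto)
    with that show ?thesis by blast
  qed
  have "\<forall>x\<in>{-b..b}. has_f_deriv b f g (r div 2) x \<and> f_deriv b f g (r div 2) x = G (r div 2) x"
  proof (rule f_deriv_eqI[OF b nz])
    fix k x assume k: "k < r div 2" and x: "x \<in> {-b..b}"
    then have "2 * k \<le> r" "2 * Suc k \<le> r" by auto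
    have "((\<lambda>s. u k s * G k s) has_vector_derivative u k x * G (Suc k) x) (at x within {-b..b})"
      by (rule G_deriv[OF order_refl x refl derivative_growth_endpoints[OF b] derivative_growth_endpoints[OF b]])
         fact+
    then show "((\<lambda>s. f s powi ((-1) ^ Suc k) * G k s) has_vector_derivative
        f x powi ((-1) ^ Suc k) * G (Suc k) x) (at x within {-b..b})"
      by (simp only: u_def)
  next
    show "\<forall>\<^sub>F y in at x within {-b..b}. y \<in> {-b..b}" for x
      by (simp add: eventually_at_filter)
  qed (use G_0 in auto)
  then show ?thesis
    using interior b by auto
qed

end
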